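(* There is an absolute constant $c>0$ such that the following holds. Let $N\ge 1$, $\alpha\in(0,1]$, and let $A\subset[N]=\{1,\ldots,N\}$ have size at least $\alpha N$. Then $A+A+A$ contains an arithmetic progression of length at least \[ \alpha\exp\left(\left(\frac{c\log N}{\log^3(2/\alpha)}\right)^{1/2}\right). \]
   Context: $A+A+A=\{a_1+a_2+a_3: a_i\in A\}$. The length of an arithmetic progression is its number of terms. *)

theory Defs
  imports Complex_Main "HOL-Library.Set_Algebras"
begin

text \<open>
  The progression a, a + d, ..., a + (k - 1) d with k terms.  The common difference must be
  positive (otherwise k would not be the number of distinct terms); for finite progressions of
  natural numbers, positive and nonzero integer differences give the same sets.
\<close>

definition is_arith_prog :: "nat \<Rightarrow> nat set \<Rightarrow> bool"
  where "is_arith_prog k P \<longleftrightarrow> (\<exists>a d. d > 0 \<and> P = (\<lambda>i. a + i * d) ` {..<k})"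

end

theory Submission
  imports
    Defs
    "HOL-Analysis.Kronecker_Approximation_Theorem"
    "HOL-Analysis.Harmonic_Numbers"
begin

text \<open>
  Choosing a popular sum \<open>x\<close> of \<open>A + A\<close>, the set \<open>B\<close> of all \<open>a \<in> A\<close> with \<open>x - a \<in> A\<close> has density at least
  \<open>\<alpha>\<^sup>2 / 2\<close>, and \<open>A + A + A\<close> contains a translate of \<open>B + B - B\<close>. For the latter set consider the function
  \<open>f(y) = E\<^sub>a 1(y + a \<in> B + B)\<close>, with \<open>a\<close> ranging over \<open>B\<close>, which is identically 1 on \<open>B\<close>. Random sampling
  (Croot and Sisask) yields a large set \<open>T\<close> such that \<open>f\<close> is close to its \<open>l\<close>-fold smoothing \<open>F\<close> over
  \<open>T - T\<close> outside a set of fewer than \<open>|B| / L\<close> points. The Fourier transform of \<open>F\<close> lives on the large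
  spectrum of \<open>T\<close>, which is controlled by few frequencies (Chang), so Dirichlet's theorem provides some
  \<open>D\<close> such that \<open>F\<close> hardly changes along progressions \<open>y, y + D, \<dots>, y + (L - 1) D\<close>. Some \<open>y \<in> B\<close> avoids
  all exceptional sets, and for it \<open>f > 0\<close> along the entire progression.
\<close>

section \<open>Almost periods by random sampling\<close>

text \<open>Functions on Z/M are modelled as periodic functions on the integers, so that translates
  need no reduction modulo \<open>M\<close>.\<close>

definition mod_periodic :: "nat \<Rightarrow> (int \<Rightarrow> 'a) \<Rightarrow> bool" where
  "mod_periodic M g \<longleftrightarrow> (\<forall>x. g (x mod int M) = g x)"

lemma mod_periodic_cong:
  assumes "mod_periodic M g" "x mod int M = y mod int M"
  shows "g x = g y"
  using assms unfolding mod_periodic_def by metis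

lemma mod_periodic_shift:
  assumes "mod_periodic M g"
  shows "mod_periodic M (\<lambda>x. g (x + t))"
  unfolding mod_periodic_def
  using mod_periodic_cong[OF assms] by (metis mod_add_left_eq)

lemma mod_periodic_sum_shifts:
  fixes s :: "int \<Rightarrow> real"
  assumes "mod_periodic M s"
  shows "mod_periodic M (\<lambda>x. (\<Sum>i\<in>I. s (x + g i)) / c)"
proof -
  have "s (x mod int M + u) = s (x + u)" for x u
    by (rule mod_periodic_cong[OF assms]) (simp add: mod_add_left_eq)
  then show ?thesis by (simp add: mod_periodic_def)
qed

lemma bij_betw_shift_mod:
  assumes "M > 0"
  shows "bij_betw (\<lambda>x. (x + t) mod int M) {0..<int M} {0..<int M}"
proof (rule bij_betw_byWitness[where f' = "\<lambda>x. (x - t) mod int M"])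
  show "\<forall>a\<in>{0..<int M}. ((a + t) mod int M - t) mod int M = a"
    by (simp add: mod_diff_left_eq)
  show "\<forall>a\<in>{0..<int M}. ((a - t) mod int M + t) mod int M = a"
    by (simp add: mod_add_left_eq)
qed (use assms in auto)

lemma sum_shift_periodic:
  fixes g :: "int \<Rightarrow> 'a::comm_monoid_add"
  assumes "M > 0" "mod_periodic M g"
  shows "(\<Sum>x\<in>{0..<int M}. g (x + t)) = (\<Sum>x\<in>{0..<int M}. g x)"
proof -
  have "(\<Sum>x\<in>{0..<int M}. g (x + t)) = (\<Sum>x\<in>{0..<int M}. g ((x + t) mod int M))"
    using assms(2) by (simp add: mod_periodic_def)
  also have "\<dots> = (\<Sum>x\<in>{0..<int M}. g x)"
    using sum.reindex_bij_betw[OF bij_betw_shift_mod[OF assms(1), of t], of g] .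
  finally show ?thesis .
qed

text \<open>
  An \<open>L\<^sup>1\<close> norm truncated at height \<open>e\<close>. It is translation invariant and convex, and it plays the role
  of the \<open>L\<^sup>p\<close> norm for large \<open>p\<close>.
\<close>
definition excess :: "nat \<Rightarrow> real \<Rightarrow> (int \<Rightarrow> real) \<Rightarrow> real" where
  "excess M e g = (\<Sum>x\<in>{0..<int M}. max 0 (\<bar>g x\<bar> - e))"

text \<open>Substitute for the triangle inequality; the truncation heights add because
  \<open>|u + v| - (e + e') \<le> (|u| - e) + (|v| - e')\<close>.\<close>

lemma excess_add_le:
  "excess M (e + e') (\<lambda>x. g x + h x) \<le> excess M e g + excess M e' h"
  unfolding excess_def sum.distrib[symmetric] by (intro sum_mono) auto

lemma excess_minus: "excess M e (\<lambda>x. - g x) = excess M e g"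
  unfolding excess_def by simp

lemma excess_shift:
  assumes "M > 0" "mod_periodic M g"
  shows "excess M e (\<lambda>x. g (x + t)) = excess M e g"
  unfolding excess_def
  using sum_shift_periodic[of M "\<lambda>x. max 0 (\<bar>g x\<bar> - e)" t] assms
  by (simp add: mod_periodic_def)

text \<open>Convexity of \<open>max 0 (|u| - e)\<close> in \<open>u\<close>. It makes averaging over
  translates free of loss.\<close>

lemma excess_average_le:
  assumes "finite I" "I \<noteq> {}" "\<And>i. i \<in> I \<Longrightarrow> excess M e (g i) \<le> B"
  shows "excess M e (\<lambda>x. (\<Sum>i\<in>I. g i x) / card I) \<le> B"
proof -
  have c: "real (card I) > 0" using assms by (simp add: card_gt_0_iff)
  have "max 0 (\<bar>(\<Sum>i\<in>I. g i x) / card I\<bar> - e) \<le> (\<Sum>i\<in>I. max 0 (\<bar>g i x\<bar> - e)) / card I" for x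
  proof -
    have "\<bar>\<Sum>i\<in>I. g i x\<bar> \<le> (\<Sum>i\<in>I. \<bar>g i x\<bar>)" by (rule sum_abs)
    also have "\<dots> \<le> (\<Sum>i\<in>I. max 0 (\<bar>g i x\<bar> - e) + e)" by (intro sum_mono) auto
    also have "\<dots> = (\<Sum>i\<in>I. max 0 (\<bar>g i x\<bar> - e)) + card I * e" by (simp add: sum.distrib)
    finally have "\<bar>(\<Sum>i\<in>I. g i x) / card I\<bar> - e \<le> (\<Sum>i\<in>I. max 0 (\<bar>g i x\<bar> - e)) / card I"
      using c by (simp add: pos_divide_le_eq diff_le_eq add_divide_distrib distrib_right mult.commute[of e])
    moreover have "0 \<le> (\<Sum>i\<in>I. max 0 (\<bar>g i x\<bar> - e)) / card I"
      by (intro divide_nonneg_nonneg sum_nonneg) auto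
    ultimately show ?thesis by simp
  qed
  then have "excess M e (\<lambda>x. (\<Sum>i\<in>I. g i x) / card I)
      \<le> (\<Sum>x\<in>{0..<int M}. (\<Sum>i\<in>I. max 0 (\<bar>g i x\<bar> - e)) / card I)"
    unfolding excess_def by (intro sum_mono)
  also have "\<dots> = (\<Sum>i\<in>I. excess M e (g i)) / card I"
    unfolding excess_def by (subst sum.swap) (simp add: sum_divide_distrib)
  also have "\<dots> \<le> B"
    using sum_bounded_above[of I "\<lambda>i. excess M e (g i)" B] assms c by (simp add: field_simps)
  finally show ?thesis .
qed

text \<open>Markov: each point above \<open>2 * e\<close> contributes more than \<open>e\<close>.
  This converts a bound on the excess into a count of exceptional points.\<close>

lemma card_exceed_le:
  assumes "e > 0"
  shows "real (card {x\<in>{0..<int M}. \<bar>g x\<bar> > 2 * e}) * e \<le> excess M e g"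
proof -
  have "real (card {x\<in>{0..<int M}. \<bar>g x\<bar> > 2 * e}) * e
      = (\<Sum>x\<in>{x\<in>{0..<int M}. \<bar>g x\<bar> > 2 * e}. e)" by simp
  also have "\<dots> \<le> (\<Sum>x\<in>{x\<in>{0..<int M}. \<bar>g x\<bar> > 2 * e}. max 0 (\<bar>g x\<bar> - e))"
    by (intro sum_mono) auto
  also have "\<dots> \<le> excess M e g"
    unfolding excess_def by (intro sum_mono2) auto
  finally show ?thesis .
qed

section \<open>Exponential moments and concentration of random samples\<close>

lemma exp_le_quadratic:
  fixes x :: real
  assumes "\<bar>x\<bar> \<le> 1"
  shows "exp x \<le> 1 + x + x\<^sup>2"
proof (cases "x \<ge> 0")
  case True
  then show ?thesis using assms exp_bound[of x] by simp
next
  case False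
  define u where "u = - x"
  have u: "u > 0" using False u_def by simp
  \<comment> \<open>For negative arguments, this identity and \<open>1 + u \<le> exp u\<close> bound
    \<open>exp (- u)\<close> from above.\<close>
  have "(1 + u) * (1 - u + u\<^sup>2) = 1 + u ^ 3"
    by (simp add: power2_eq_square power3_eq_cube algebra_simps)
  then have "1 \<le> (1 + u) * (1 - u + u\<^sup>2)" using u by simp
  also have "\<dots> \<le> exp u * (1 - u + u\<^sup>2)"
  proof (intro mult_right_mono)
    have "u\<^sup>2 - u + 1 = (u - 1/2)\<^sup>2 + 3/4" by (simp add: power2_eq_square algebra_simps)
    then show "0 \<le> 1 - u + u\<^sup>2" using zero_le_power2[of "u-1/2"] by linarith
  qed (use exp_ge_add_one_self[of u] in simp)
  finally have "exp (- u) \<le> 1 - u + u\<^sup>2"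
    by (simp add: exp_minus field_simps)
  then show ?thesis by (simp add: u_def)
qed

text \<open>The sum over tuples factors into \<open>k\<close> equal sums. In each of them the linear
  term of the quadratic bound for \<open>exp\<close> cancels because \<open>v\<close> has mean
  0.\<close>

lemma sum_exp_sum_le:
  fixes v :: "'a \<Rightarrow> real"
  assumes "finite A" "A \<noteq> {}" "\<And>a. a \<in> A \<Longrightarrow> \<bar>v a\<bar> \<le> 1" "(\<Sum>a\<in>A. v a) = 0" "\<bar>s\<bar> \<le> 1"
  shows "(\<Sum>g\<in>PiE {..<k} (\<lambda>_. A). exp (s * (\<Sum>i<k. v (g i)))) \<le> real (card A) ^ k * exp (s\<^sup>2 * k)"
proof -
  have "(\<Sum>a\<in>A. exp (s * v a)) \<le> (\<Sum>a\<in>A. 1 + s * v a + s\<^sup>2)"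
  proof (intro sum_mono)
    fix a assume a: "a \<in> A"
    have "\<bar>s * v a\<bar> \<le> 1" using assms(3)[OF a] assms(5) by (simp add: abs_mult mult_le_one)
    then have "exp (s * v a) \<le> 1 + s * v a + (s * v a)\<^sup>2" by (rule exp_le_quadratic)
    also have "(s * v a)\<^sup>2 \<le> s\<^sup>2 * 1"
      unfolding power_mult_distrib using assms(3)[OF a]
      by (intro mult_left_mono) (auto simp: abs_square_le_1)
    finally show "exp (s * v a) \<le> 1 + s * v a + s\<^sup>2" by simp
  qed
  also have "\<dots> = card A * (1 + s\<^sup>2)"
    using assms(4) by (simp add: sum.distrib sum_distrib_left[symmetric] algebra_simps)
  also have "\<dots> \<le> card A * exp (s\<^sup>2)" by (intro mult_left_mono) auto
  finally have le: "(\<Sum>a\<in>A. exp (s * v a)) \<le> card A * exp (s\<^sup>2)" .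
  have "(\<Sum>g\<in>PiE {..<k} (\<lambda>_. A). exp (s * (\<Sum>i<k. v (g i))))
      = (\<Sum>g\<in>PiE {..<k} (\<lambda>_. A). \<Prod>i<k. exp (s * v (g i)))"
    by (simp add: sum_distrib_left exp_sum)
  also have "\<dots> = (\<Sum>a\<in>A. exp (s * v a)) ^ k"
    using prod_sum_PiE[of "{..<k}" "\<lambda>_. A" "\<lambda>_ a. exp (s * v a)"] assms(1) by simp
  also have "\<dots> \<le> (card A * exp (s\<^sup>2)) ^ k"
    by (intro power_mono le sum_nonneg) auto
  also have "\<dots> = real (card A) ^ k * exp (s\<^sup>2 * k)"
    by (simp add: power_mult_distrib exp_of_nat_mult[symmetric] mult.commute)
  finally show ?thesis .
qed

text \<open>Chernoff's bound for the mean of a uniform sample with replacement, in truncated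
  form.\<close>

lemma sum_sampling_excess_le:
  fixes v :: "'a \<Rightarrow> real" and m e :: real
  assumes "finite A" "A \<noteq> {}" "\<And>a. a \<in> A \<Longrightarrow> \<bar>v a - m\<bar> \<le> 1" "(\<Sum>a\<in>A. v a) = card A * m"
    and "0 < e" "e \<le> 1" "e * k \<ge> 2"
  shows "(\<Sum>g\<in>PiE {..<k} (\<lambda>_. A). max 0 (\<bar>(\<Sum>i<k. v (g i)) / k - m\<bar> - e))
    \<le> 2 * exp (- e\<^sup>2 * k / 4) * real (card A) ^ k"
proof -
  have k: "k > 0" using assms(5,7) by (cases k) auto
  \<comment> \<open>This minimises the exponent \<open>s\<^sup>2 * k - s * k * e\<close>, with value
    \<open>- e\<^sup>2 * k / 4\<close>. The assumption \<open>e * k \<ge> 2\<close> gives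
    \<open>s * k \<ge> 1\<close>, so that \<open>exp (s * k * y)\<close> dominates
    \<open>y\<close>.\<close>
  define s where "s = e / 2"
  have s: "0 < s" "\<bar>s\<bar> \<le> 1" "s * k \<ge> 1" using assms by (auto simp: s_def)
  define W where "W = (\<lambda>g. \<Sum>i<k. v (g i) - m)"
  have pt: "max 0 (\<bar>(\<Sum>i<k. v (g i)) / k - m\<bar> - e)
      \<le> exp (- s * k * e) * (exp (s * W g) + exp ((- s) * W g))" for g
  proof -
    have X: "(\<Sum>i<k. v (g i)) / k - m = W g / k"
      using k by (simp add: W_def sum_subtractf field_simps)
    define y where "y = \<bar>W g / k\<bar> - e"
    have ks: "s * k * y = s * \<bar>W g\<bar> - s * k * e"
      using k by (simp add: y_def field_simps)
    have "max 0 y \<le> exp (s * k * y)"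
    proof (cases "y \<le> 0")
      case False
      then have "y \<le> s * k * y" using s(3) by (simp add: mult_le_cancel_right1)
      also have "\<dots> \<le> exp (s * k * y)" using exp_ge_add_one_self[of "s*k*y"] by linarith
      finally show ?thesis using False by simp
    qed simp
    also have "\<dots> = exp (- s * k * e) * exp (s * \<bar>W g\<bar>)"
      unfolding ks exp_add[symmetric] by simp
    also have "\<dots> \<le> exp (- s * k * e) * (exp (s * W g) + exp ((- s) * W g))"
      by (intro mult_left_mono) (auto simp: abs_if)
    finally show ?thesis by (simp add: X y_def)
  qed
  have b: "(\<Sum>g\<in>PiE {..<k} (\<lambda>_. A). exp (r * W g)) \<le> real (card A) ^ k * exp (s\<^sup>2 * k)"
    if "r = s \<or> r = - s" for r
    using sum_exp_sum_le[of A "\<lambda>a. v a - m" r k] that assms(1-4) s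
    unfolding W_def by (auto simp: sum_subtractf)
  have "(\<Sum>g\<in>PiE {..<k} (\<lambda>_. A). max 0 (\<bar>(\<Sum>i<k. v (g i)) / k - m\<bar> - e))
     \<le> (\<Sum>g\<in>PiE {..<k} (\<lambda>_. A). exp (- s * k * e) * (exp (s * W g) + exp ((- s) * W g)))"
    by (intro sum_mono pt)
  also have "\<dots> = exp (- s * k * e) * ((\<Sum>g\<in>PiE {..<k} (\<lambda>_. A). exp (s * W g))
      + (\<Sum>g\<in>PiE {..<k} (\<lambda>_. A). exp ((- s) * W g)))"
    by (simp only: sum_distrib_left[symmetric] sum.distrib)
  also have "\<dots> \<le> exp (- s * k * e) * (real (card A) ^ k * exp (s\<^sup>2 * k) + real (card A) ^ k * exp (s\<^sup>2 * k))"
    by (intro mult_left_mono add_mono b) auto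
  also have "\<dots> = 2 * (exp (- s * k * e) * exp (s\<^sup>2 * k)) * real (card A) ^ k"
    by simp
  also have "exp (- s * k * e) * exp (s\<^sup>2 * k) = exp (- e\<^sup>2 * k / 4)"
    unfolding exp_add[symmetric] by (simp add: s_def power2_eq_square field_simps)
  finally show ?thesis .
qed

lemma card_le_half_mult_Markov:
  fixes f :: "'a \<Rightarrow> real" and b :: real
  assumes "finite G" "\<And>g. g \<in> G \<Longrightarrow> f g \<ge> 0" "(\<Sum>g\<in>G. f g) \<le> b * card G" "b > 0"
  shows "real (card {g\<in>G. f g \<le> 2 * b}) \<ge> card G / 2"
proof -
  have "real (card {g\<in>G. f g > 2 * b}) * (2 * b) = (\<Sum>g\<in>{g\<in>G. f g > 2 * b}. 2 * b)" by simp
  also have "\<dots> \<le> (\<Sum>g\<in>{g\<in>G. f g > 2 * b}. f g)" by (intro sum_mono) auto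
  also have "\<dots> \<le> (\<Sum>g\<in>G. f g)" using assms by (intro sum_mono2) auto
  also have "\<dots> \<le> b * card G" by fact
  finally have "real (card {g\<in>G. f g > 2 * b}) \<le> card G / 2" using assms(4) by simp
  moreover have "card G = card {g\<in>G. f g \<le> 2 * b} + card {g\<in>G. f g > 2 * b}"
    by (subst card_Un_disjoint[symmetric]) (use assms in \<open>auto intro!: arg_cong[of _ _ card]\<close>)
  ultimately show ?thesis by simp
qed

text \<open>
  Croot--Sisask sampling. Most \<open>k\<close>-tuples from \<open>A\<close> represent the average \<open>f\<close> well, and by pigeonhole many
  translates of good tuples along the diagonal coincide; two such translates differ by an almost
  period of \<open>f\<close>.
\<close>
lemma almost_periods_exist:
  fixes A :: "int set" and s :: "int \<Rightarrow> real"
  assumes "M > 0" "N > 0" "A \<subseteq> {1..int N}" "A \<noteq> {}"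
    and "mod_periodic M s" "\<And>x. 0 \<le> s x" "\<And>x. s x \<le> 1"
    and "0 < e" "e \<le> 1" "e * k \<ge> 2"
  defines "f \<equiv> (\<lambda>y. (\<Sum>a\<in>A. s (y + a)) / card A)"
  obtains T where "T \<subseteq> {1..int N}" "real (card T) * (2 * (2 * real N) ^ k) \<ge> real N * real (card A) ^ k"
    "\<And>t t'. t \<in> T \<Longrightarrow> t' \<in> T \<Longrightarrow>
       excess M (2 * e) (\<lambda>y. f (y + t - t') - f y) \<le> 8 * real M * exp (- e\<^sup>2 * k / 4)"
proof -
  have fin: "finite A" using assms(3) finite_subset by blast
  have cA: "real (card A) > 0" using fin assms(4) by (simp add: card_gt_0_iff)
  define b where "b = 2 * M * exp (- e\<^sup>2 * k / 4)"
  have b: "b > 0" using assms(1) by (simp add: b_def)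
  define F where "F = (\<lambda>(g::nat \<Rightarrow> int) y. (\<Sum>i<k. s (y + g i)) / k)"
  define P where "P = PiE {..<k} (\<lambda>_. A)"
  have finP: "finite P" unfolding P_def using fin by (intro finite_PiE) auto
  have cP: "real (card P) = real (card A) ^ k" unfolding P_def by (simp add: card_funcsetE)
  define G where "G = {g\<in>P. excess M e (\<lambda>y. F g y - f y) \<le> 2 * b}"
  \<comment> \<open>The sums are exchanged so that concentration applies at each point
    \<open>y\<close> separately, where the sampled values \<open>s (y + a)\<close> have mean
    \<open>f y\<close>.\<close>
  have "(\<Sum>g\<in>P. excess M e (\<lambda>y. F g y - f y))
      = (\<Sum>y\<in>{0..<int M}. \<Sum>g\<in>P. max 0 (\<bar>F g y - f y\<bar> - e))"
    unfolding excess_def by (rule sum.swap)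
  also have "\<dots> \<le> (\<Sum>y\<in>{0..<int M}. 2 * exp (- e\<^sup>2 * k / 4) * real (card A) ^ k)"
    unfolding P_def F_def
  proof (intro sum_mono sum_sampling_excess_le)
    fix y a assume "a \<in> A"
    have "0 \<le> f y" unfolding f_def by (intro divide_nonneg_nonneg sum_nonneg assms) auto
    moreover have "f y \<le> 1" unfolding f_def
      using sum_bounded_above[of A "\<lambda>a. s (y + a)" 1] assms(7) cA by (simp add: field_simps)
    ultimately show "\<bar>s (y + a) - f y\<bar> \<le> 1" using assms(6)[of "y+a"] assms(7)[of "y+a"] by linarith
  next
    fix y show "(\<Sum>a\<in>A. s (y + a)) = card A * f y" using cA by (simp add: f_def)
  qed (use assms fin in auto)
  also have "\<dots> = b * card P" by (simp add: b_def cP)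
  finally have "real (card G) \<ge> card P / 2"
    unfolding G_def using finP b
    by (intro card_le_half_mult_Markov) (auto simp: excess_def intro!: sum_nonneg)
  then have cG: "real (card G) \<ge> real (card A) ^ k / 2" by (simp add: cP)
  have finG: "finite G" using finP by (simp add: G_def)
  define \<Psi> where "\<Psi> = (\<lambda>(t::int, g::nat \<Rightarrow> int). restrict (\<lambda>i. g i + t) {..<k})"
  define Z where "Z = PiE {..<k} (\<lambda>_. {1..2 * int N})"
  have finZ: "finite Z" unfolding Z_def by (intro finite_PiE) auto
  have "nat (2 * int N) = 2 * N" by simp
  then have cZ: "card Z = (2 * N) ^ k" unfolding Z_def by (simp add: card_funcsetE)
  have Zne: "Z \<noteq> {}" using cZ assms(2) by (metis card.empty mult_is_0 neq0_conv power_not_zero zero_neq_numeral)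
  have "\<exists>z\<in>Z. card ({1..int N} \<times> G) \<le> card (\<Psi> -` {z} \<inter> ({1..int N} \<times> G)) * card Z"
  proof (rule pigeonhole_card)
    show "\<Psi> \<in> {1..int N} \<times> G \<rightarrow> Z"
    proof
      fix p assume "p \<in> {1..int N} \<times> G"
      then obtain t g where p: "p = (t, g)" "1 \<le> t" "t \<le> int N" "g \<in> P" by (auto simp: G_def)
      have "g i \<in> {1..int N}" if "i < k" for i
        using p(4) that assms(3) unfolding P_def by (auto simp: PiE_iff)
      then have "g i + t \<in> {1..2 * int N}" if "i < k" for i
        using p(2,3) that by fastforce
      then show "\<Psi> p \<in> Z" unfolding p(1) \<Psi>_def Z_def by auto
    qed
  qed (use finG finZ Zne in auto)
  then obtain z where z: "card ({1..int N} \<times> G) \<le> card (\<Psi> -` {z} \<inter> ({1..int N} \<times> G)) * card Z"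
    by blast
  define X where "X = \<Psi> -` {z} \<inter> ({1..int N} \<times> G)"
  define T where "T = fst ` X"
  \<comment> \<open>On the fibre over \<open>z\<close> the shift \<open>t\<close> determines the
    tuple as \<open>z - t\<close>, so that counting shifts loses nothing.\<close>
  have "inj_on fst X"
  proof (rule inj_onI)
    fix p q assume p: "p \<in> X" and q: "q \<in> X"
      and eq: "fst p = fst q"
    obtain t g where p': "p = (t, g)" by (cases p)
    obtain h where q': "q = (t, h)" using eq p' by (cases q) auto
    have "g = h"
    proof (rule PiE_ext)
      show "g \<in> PiE {..<k} (\<lambda>_. A)" "h \<in> PiE {..<k} (\<lambda>_. A)"
        using p q p' q' by (auto simp: G_def P_def X_def)
      fix i assume i: "i \<in> {..<k}"
      have "\<Psi> (t, g) i = \<Psi> (t, h) i" using p q p' q' by (auto simp: X_def)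
      then show "g i = h i" using i by (simp add: \<Psi>_def)
    qed
    then show "p = q" using p' q' by simp
  qed
  then have cT: "card T = card X" unfolding T_def by (rule card_image)
  have "real N * card G \<le> real (card T) * (2 * real N) ^ k"
  proof -
    have "N * card G \<le> card T * (2 * N) ^ k" using z cT cZ X_def by (simp add: card_cartesian_product)
    then have "real (N * card G) \<le> real (card T * (2 * N) ^ k)" by (rule of_nat_mono)
    then show ?thesis by simp
  qed
  moreover have "real N * (real (card A) ^ k / 2) \<le> real N * card G"
    by (intro mult_left_mono cG) auto
  ultimately have c: "real (card T) * (2 * (2 * real N) ^ k) \<ge> real N * real (card A) ^ k" by linarith
  have s: "T \<subseteq> {1..int N}" by (auto simp: T_def X_def)
  have periods: "excess M (2 * e) (\<lambda>y. f (y + t - t') - f y) \<le> 8 * real M * exp (- e\<^sup>2 * k / 4)"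
    if t: "t \<in> T" and t': "t' \<in> T" for t t'
  proof -
    have perf: "mod_periodic M f"
      unfolding f_def by (rule mod_periodic_sum_shifts[OF assms(5)])
    have perF: "mod_periodic M (F g)" for g
      unfolding F_def by (rule mod_periodic_sum_shifts[OF assms(5)])
    have per_minus: "mod_periodic M (\<lambda>y. p y - q y)" if "mod_periodic M p" "mod_periodic M q" for p q :: "int \<Rightarrow> real"
      using that by (simp add: mod_periodic_def)
    \<comment> \<open>If \<open>g + u = z\<close> with \<open>g\<close> good, then
      \<open>F z\<close> is the translate of \<open>F g\<close> by \<open>u\<close>. Thus the single
      function \<open>F z\<close> approximates every translate of \<open>f\<close> by an element of
      \<open>T\<close>.\<close>
    have close: "excess M e (\<lambda>y. F z y - f (y + u)) \<le> 2 * b" if u: "u \<in> T" for u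
    proof -
      obtain p where "p \<in> X" "u = fst p"
        using u by (auto simp: T_def)
      then obtain g where g: "g \<in> G" "\<Psi> (u, g) = z" by (cases p) (auto simp: X_def)
      have "F z y = F g (y + u)" for y
        unfolding F_def g(2)[symmetric] by (simp add: \<Psi>_def algebra_simps)
      then have "excess M e (\<lambda>y. F z y - f (y + u)) = excess M e (\<lambda>y. F g (y + u) - f (y + u))" by simp
      also have "\<dots> = excess M e (\<lambda>y. F g y - f y)"
        using excess_shift[OF assms(1) per_minus[OF perF perf], of e g u] by simp
      finally show ?thesis using g by (simp add: G_def)
    qed
    \<comment> \<open>Translation by \<open>t'\<close> leads to a comparison of
      \<open>f (y + t)\<close> with \<open>f (y + t')\<close>, both of which are close to
      \<open>F z y\<close>.\<close>
    have periods: "excess M (2 * e) (\<lambda>y. f (y + t - t') - f y)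
        = excess M (2 * e) (\<lambda>y. f (y + t' + t - t') - f (y + t'))"
      using excess_shift[OF assms(1) per_minus[OF mod_periodic_shift[OF perf, of "t - t'"] perf], of "2 * e" t']
      by (simp add: algebra_simps)
    also have "\<dots> = excess M (e + e) (\<lambda>y. - (F z y - f (y + t)) + (F z y - f (y + t')))"
      by (simp add: algebra_simps)
    also have "\<dots> \<le> excess M e (\<lambda>y. - (F z y - f (y + t))) + excess M e (\<lambda>y. F z y - f (y + t'))"
      by (rule excess_add_le)
    also have "\<dots> \<le> 2 * b + 2 * b" unfolding excess_minus by (intro add_mono close t t')
    finally show ?thesis by (simp add: b_def)
  qed
  show thesis by (rule that[OF s c]) (rule periods)
qed

section \<open>Iterated smoothing over differences of almost periods\<close>

text \<open>Averaging over \<open>T - T\<close> instead of \<open>T\<close> makes the Fourier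
  multiplier real and nonnegative: it is the square of the modulus of the multiplier of
  \<open>T\<close>.\<close>

definition smooth :: "int set \<Rightarrow> (int \<Rightarrow> real) \<Rightarrow> int \<Rightarrow> real" where
  "smooth T g x = (\<Sum>(t, t')\<in>T \<times> T. g (x + t - t')) / card (T \<times> T)"

lemma smooth_diff: "smooth T g x - smooth T h x = smooth T (\<lambda>x. g x - h x) x"
  unfolding smooth_def by (simp add: sum_subtractf diff_divide_distrib case_prod_beta)

lemma mod_periodic_smooth:
  assumes "mod_periodic M g"
  shows "mod_periodic M (smooth T g)"
proof -
  have "g (x mod int M + t - t') = g (x + t - t')" for x t t'
    by (rule mod_periodic_cong[OF assms]) (simp add: mod_add_left_eq mod_diff_left_eq add_diff_eq[symmetric])
  then show ?thesis by (simp add: mod_periodic_def smooth_def)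
qed

lemma excess_smooth_le:
  assumes "M > 0" "mod_periodic M g" "finite T" "T \<noteq> {}"
  shows "excess M e (smooth T g) \<le> excess M e g"
proof -
  have "excess M e (\<lambda>x. (\<Sum>p\<in>T\<times>T. g (x + (fst p - snd p))) / card (T\<times>T)) \<le> excess M e g"
    by (rule excess_average_le) (use assms excess_shift in auto)
  moreover have "smooth T g = (\<lambda>x. (\<Sum>p\<in>T\<times>T. g (x + (fst p - snd p))) / card (T\<times>T))"
    by (auto simp: smooth_def fun_eq_iff case_prod_beta add_diff_eq)
  ultimately show ?thesis by simp
qed

text \<open>Telescoping: with \<open>S = smooth T\<close>, the new error is \<open>S\<close> applied
  to the old error plus \<open>S f - f\<close>. As \<open>S\<close> does not increase the excess,
  each step adds one \<open>e\<close> to the height and one \<open>b\<close> to the bound.\<close>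

lemma excess_funpow_smooth_le:
  assumes "M > 0" "mod_periodic M f" "finite T" "T \<noteq> {}"
    and "\<And>t t'. t \<in> T \<Longrightarrow> t' \<in> T \<Longrightarrow> excess M e (\<lambda>y. f (y + t - t') - f y) \<le> b"
  shows "excess M (l * e) (\<lambda>y. (smooth T ^^ l) f y - f y) \<le> l * b"
proof (induction l)
  case 0
  then show ?case by (simp add: excess_def)
next
  case (Suc l)
  define h where "h = (\<lambda>y. (smooth T ^^ l) f y - f y)"
  have "mod_periodic M ((smooth T ^^ l) f)"
    by (induction l) (use assms mod_periodic_smooth in auto)
  then have ph: "mod_periodic M h" using assms(2) by (simp add: mod_periodic_def h_def)
  have c: "real (card (T \<times> T)) > 0" using assms by (simp add: card_gt_0_iff)
  have "excess M e (\<lambda>y. (\<Sum>p\<in>T\<times>T. f (y + fst p - snd p) - f y) / card (T\<times>T)) \<le> b"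
    by (rule excess_average_le) (use assms in auto)
  moreover have "(\<Sum>p\<in>T\<times>T. f (y + fst p - snd p) - f y) / card (T\<times>T) = smooth T f y - f y" for y
    using c by (simp add: smooth_def sum_subtractf diff_divide_distrib case_prod_beta)
  ultimately have 1: "excess M e (\<lambda>y. smooth T f y - f y) \<le> b" by simp
  have "(\<lambda>y. (smooth T ^^ Suc l) f y - f y) = (\<lambda>y. smooth T h y + (smooth T f y - f y))"
    by (simp add: h_def smooth_diff[symmetric])
  then have "excess M (Suc l * e) (\<lambda>y. (smooth T ^^ Suc l) f y - f y)
      = excess M (l * e + e) (\<lambda>y. smooth T h y + (smooth T f y - f y))"
    by (simp add: algebra_simps)
  also have "\<dots> \<le> excess M (l * e) (smooth T h) + excess M e (\<lambda>y. smooth T f y - f y)"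
    by (rule excess_add_le)
  also have "\<dots> \<le> l * b + b"
    using excess_smooth_le[OF assms(1) ph assms(3,4), of "l * e"] Suc.IH 1 by (simp add: h_def)
  finally show ?case by (simp add: algebra_simps)
qed

section \<open>Fourier analysis on residues\<close>

definition unit_char :: "nat \<Rightarrow> int \<Rightarrow> complex" where
  "unit_char M x = cis (2 * pi * of_int x / of_nat M)"

lemma norm_unit_char [simp]: "norm (unit_char M x) = 1"
  by (simp add: unit_char_def)

lemma unit_char_0 [simp]: "unit_char M 0 = 1"
  by (simp add: unit_char_def)

lemma unit_char_add: "unit_char M (x + y) = unit_char M x * unit_char M y"
  by (simp add: unit_char_def cis_mult add_divide_distrib distrib_left)

lemma unit_char_minus: "unit_char M (- x) = cnj (unit_char M x)"
  by (simp add: unit_char_def cis_cnj)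

lemma unit_char_sum: "unit_char M (\<Sum>i\<in>I. g i) = (\<Prod>i\<in>I. unit_char M (g i))"
  by (induction I rule: infinite_finite_induct) (auto simp: unit_char_add)

lemma unit_char_eq_1_iff:
  assumes "M > 0"
  shows "unit_char M x = 1 \<longleftrightarrow> int M dvd x"
proof
  assume "unit_char M x = 1"
  then have "cos (2 * pi * of_int x / of_nat M) = 1"
    by (simp add: unit_char_def complex_eq_iff)
  then obtain n :: int where "2 * pi * of_int x / of_nat M = of_int n * 2 * pi"
    unfolding cos_one_2pi_int by blast
  then have "real_of_int x = of_int (int M * n)" using assms by (simp add: field_simps)
  then show "int M dvd x" by (metis dvd_triv_left of_int_eq_iff)
next
  assume "int M dvd x"
  then obtain n where "x = int M * n" by blast
  then show "unit_char M x = 1"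
    using assms cis_multiple_2pi[of "of_int n"] by (simp add: unit_char_def mult.assoc)
qed

lemma unit_char_cong:
  assumes "M > 0" "int M dvd x - y"
  shows "unit_char M x = unit_char M y"
  using unit_char_add[of M "x - y" y] unit_char_eq_1_iff[of M "x - y"] assms by simp

text \<open>Replacing \<open>r\<close> by \<open>r + 1\<close> permutes the residues and multiplies
  the sum by \<open>unit_char M x\<close>, so the sum vanishes unless this factor is 1.\<close>

lemma sum_unit_char:
  assumes "M > 0"
  shows "(\<Sum>r\<in>{0..<int M}. unit_char M (r * x)) = (if int M dvd x then of_nat M else 0)"
proof (cases "int M dvd x")
  case True
  then have "unit_char M (r * x) = 1" for r using unit_char_eq_1_iff[OF assms] by simp
  then show ?thesis using True by simp
next
  case False
  have "mod_periodic M (\<lambda>r. unit_char M (r * x))"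
    unfolding mod_periodic_def
    by (intro allI unit_char_cong[OF assms]) (metis dvd_mult2 left_diff_distrib mod_eq_dvd_iff mod_mod_trivial)
  from sum_shift_periodic[OF assms this, of 1]
  have "(\<Sum>r\<in>{0..<int M}. unit_char M (r * x)) = (\<Sum>r\<in>{0..<int M}. unit_char M (r * x) * unit_char M x)"
    by (simp add: distrib_right unit_char_add)
  also have "\<dots> = (\<Sum>r\<in>{0..<int M}. unit_char M (r * x)) * unit_char M x"
    by (simp add: sum_distrib_right)
  finally have "(\<Sum>r\<in>{0..<int M}. unit_char M (r * x)) = 0"
    using False unit_char_eq_1_iff[OF assms, of x] by (metis mult_cancel_left1)
  then show ?thesis using False by simp
qed

lemma residues_dvd_diff_iff:
  assumes "x \<in> {0..<int M}" "y \<in> {0..<int M}"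
  shows "int M dvd x - y \<longleftrightarrow> x = y"
  using assms by (auto simp flip: mod_eq_dvd_iff)

lemma parseval:
  fixes w :: "int \<Rightarrow> real"
  assumes "M > 0" "Y \<subseteq> {0..<int M}"
  shows "(\<Sum>r\<in>{0..<int M}. (norm (\<Sum>y\<in>Y. w y * unit_char M (r * y)))\<^sup>2) = M * (\<Sum>y\<in>Y. (w y)\<^sup>2)"
proof -
  have fin: "finite Y" using assms(2) finite_subset by blast
  have "complex_of_real (\<Sum>r\<in>{0..<int M}. (norm (\<Sum>y\<in>Y. w y * unit_char M (r * y)))\<^sup>2)
      = (\<Sum>r\<in>{0..<int M}. \<Sum>y\<in>Y. \<Sum>z\<in>Y. w y * w z * unit_char M (r * (y - z)))"
    unfolding of_real_sum complex_norm_square cnj_sum sum_product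
    by (intro sum.cong refl)
       (simp add: right_diff_distrib unit_char_add[of M _ "- _", simplified] unit_char_minus mult_ac)
  also have "\<dots> = (\<Sum>y\<in>Y. \<Sum>r\<in>{0..<int M}. \<Sum>z\<in>Y. w y * w z * unit_char M (r * (y - z)))"
    by (rule sum.swap)
  also have "\<dots> = (\<Sum>y\<in>Y. \<Sum>z\<in>Y. \<Sum>r\<in>{0..<int M}. w y * w z * unit_char M (r * (y - z)))"
    by (intro sum.cong refl sum.swap)
  also have "\<dots> = (\<Sum>y\<in>Y. \<Sum>z\<in>Y. w y * w z * (\<Sum>r\<in>{0..<int M}. unit_char M (r * (y - z))))"
    by (simp only: sum_distrib_left)
  also have "\<dots> = (\<Sum>y\<in>Y. \<Sum>z\<in>Y. if z = y then complex_of_real (M * (w y)\<^sup>2) else 0)"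
    using residues_dvd_diff_iff assms(2)
    by (intro sum.cong refl) (auto simp: sum_unit_char[OF assms(1)] power2_eq_square subset_iff)
  also have "\<dots> = complex_of_real (M * (\<Sum>y\<in>Y. (w y)\<^sup>2))"
    using fin by (simp add: sum_distrib_left)
  finally show ?thesis unfolding of_real_eq_iff .
qed

text \<open>The factor \<open>1 / M\<close> is placed here, so that the inversion formula carries
  none.\<close>

definition fourier_coeff :: "nat \<Rightarrow> (int \<Rightarrow> real) \<Rightarrow> int \<Rightarrow> complex" where
  "fourier_coeff M s r = (\<Sum>y\<in>{0..<int M}. s y / M * unit_char M (- (r * y)))"

lemma fourier_inversion:
  fixes s :: "int \<Rightarrow> real"
  assumes "M > 0" "mod_periodic M s"
  shows "complex_of_real (s x) = (\<Sum>r\<in>{0..<int M}. fourier_coeff M s r * unit_char M (r * x))"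
proof -
  have "(\<Sum>r\<in>{0..<int M}. fourier_coeff M s r * unit_char M (r * x))
      = (\<Sum>r\<in>{0..<int M}. \<Sum>y\<in>{0..<int M}. s y / M * unit_char M (r * (x - y)))"
    by (simp add: fourier_coeff_def sum_distrib_right sum_distrib_left right_diff_distrib unit_char_add[of M _ "- _", simplified] mult_ac)
  also have "\<dots> = (\<Sum>y\<in>{0..<int M}. s y / M * (\<Sum>r\<in>{0..<int M}. unit_char M (r * (x - y))))"
    by (subst sum.swap) (simp only: sum_distrib_left)
  also have "\<dots> = (\<Sum>y\<in>{0..<int M}. if y = x mod int M then complex_of_real (s y) else 0)"
  proof (intro sum.cong refl)
    fix y assume "y \<in> {0..<int M}"
    then have "int M dvd x - y \<longleftrightarrow> y = x mod int M" by (auto simp flip: mod_eq_dvd_iff)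
    then show "s y / M * (\<Sum>r\<in>{0..<int M}. unit_char M (r * (x - y)))
        = (if y = x mod int M then complex_of_real (s y) else 0)"
      using assms(1) by (simp add: sum_unit_char)
  qed
  also have "\<dots> = complex_of_real (s x)"
    using assms by (simp add: mod_periodic_def)
  finally show ?thesis by simp
qed

text \<open>Fourier transform of the uniform probability measure on \<open>T\<close>, with positive
  sign in the exponent.\<close>

definition char_mean :: "nat \<Rightarrow> int set \<Rightarrow> int \<Rightarrow> complex" where
  "char_mean M T r = (\<Sum>t\<in>T. unit_char M (r * t)) / card T"

lemma norm_char_mean_le_1: "norm (char_mean M T r) \<le> 1"
proof -
  have "norm (\<Sum>t\<in>T. unit_char M (r * t)) \<le> card T"
    using norm_sum[of "\<lambda>t. unit_char M (r * t)" T] by simp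
  then show ?thesis
    by (cases "card T = 0") (simp_all add: char_mean_def norm_divide divide_le_eq_1)
qed

text \<open>The average over \<open>T \<times> T\<close> factors into a character mean and its
  conjugate. The coefficients \<open>c\<close> are arbitrary so that the formula can be
  iterated.\<close>

lemma smooth_fourier:
  assumes "\<And>x. complex_of_real (g x) = (\<Sum>r\<in>R. c r * unit_char M (r * x))"
  shows "complex_of_real (smooth T g x)
    = (\<Sum>r\<in>R. c r * of_real ((norm (char_mean M T r))\<^sup>2) * unit_char M (r * x))"
proof -
  have "(\<Sum>p\<in>T\<times>T. unit_char M (r * (x + fst p - snd p))) / card (T \<times> T)
      = of_real ((norm (char_mean M T r))\<^sup>2) * unit_char M (r * x)" for r
  proof -
    have "(\<Sum>p\<in>T\<times>T. unit_char M (r * (x + fst p - snd p)))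
        = (\<Sum>t\<in>T. \<Sum>t'\<in>T. unit_char M (r * (x + t - t')))"
      by (simp add: sum.cartesian_product case_prod_beta)
    also have "\<dots> = (\<Sum>t\<in>T. \<Sum>t'\<in>T. unit_char M (r * t) * cnj (unit_char M (r * t')) * unit_char M (r * x))"
      by (simp add: right_diff_distrib distrib_left unit_char_add[of M _ "- _", simplified]
          unit_char_minus unit_char_add mult_ac)
    also have "\<dots> = (\<Sum>t\<in>T. unit_char M (r * t)) * cnj (\<Sum>t\<in>T. unit_char M (r * t)) * unit_char M (r * x)"
      by (simp only: cnj_sum sum_distrib_right, simp only: sum_distrib_left sum_distrib_right)
    finally show ?thesis
      unfolding char_mean_def complex_norm_square by (simp add: card_cartesian_product)
  qed note key = this
  have "complex_of_real (smooth T g x)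
      = (\<Sum>p\<in>T\<times>T. \<Sum>r\<in>R. c r * unit_char M (r * (x + fst p - snd p))) / card (T \<times> T)"
    by (simp add: smooth_def case_prod_beta assms)
  also have "\<dots> = (\<Sum>r\<in>R. c r * ((\<Sum>p\<in>T\<times>T. unit_char M (r * (x + fst p - snd p))) / card (T \<times> T)))"
    by (subst sum.swap) (simp add: sum_distrib_left sum_divide_distrib)
  also have "\<dots> = (\<Sum>r\<in>R. c r * of_real ((norm (char_mean M T r))\<^sup>2) * unit_char M (r * x))"
    by (simp only: key mult.assoc)
  finally show ?thesis .
qed

lemma funpow_smooth_fourier:
  assumes "\<And>x. complex_of_real (g x) = (\<Sum>r\<in>R. c r * unit_char M (r * x))"
  shows "complex_of_real ((smooth T ^^ l) g x)
    = (\<Sum>r\<in>R. c r * of_real (norm (char_mean M T r) ^ (2 * l)) * unit_char M (r * x))"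
proof (induction l arbitrary: x)
  case 0
  then show ?case using assms by simp
next
  case (Suc l)
  show ?case
    using smooth_fourier[where g = "(smooth T ^^ l) g" and R = R and M = M and T = T and x = x and
        c = "\<lambda>r. c r * of_real (norm (char_mean M T r) ^ (2 * l))", OF Suc.IH]
    by (simp add: power2_eq_square power_mult mult_ac)
qed

section \<open>The large spectrum\<close>

text \<open>The usual notion in Z/M; it keeps all nonconstant terms of a Riesz product away from
  frequency 0.\<close>

definition dissociated :: "nat \<Rightarrow> int set \<Rightarrow> bool" where
  "dissociated M \<Lambda> \<longleftrightarrow> (\<forall>\<phi>. (\<forall>r\<in>\<Lambda>. \<phi> r \<in> {-1, 0, 1}) \<longrightarrow> int M dvd (\<Sum>r\<in>\<Lambda>. \<phi> r * r) \<longrightarrow> (\<forall>r\<in>\<Lambda>. \<phi> r = 0))"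

text \<open>Each factor combines the frequencies \<open>- r\<close>, \<open>0\<close> and
  \<open>r\<close>. A choice \<open>\<phi>\<close> of one term per factor survives the sum over
  \<open>x\<close> only if its total frequency vanishes modulo \<open>M\<close>, and by
  dissociativity only the zero choice does.\<close>

lemma sum_riesz_product:
  fixes b s :: real
  assumes "M > 0" "finite \<Lambda>" "dissociated M \<Lambda>"
  shows "(\<Sum>x\<in>{0..<int M}. \<Prod>r\<in>\<Lambda>. b + s * Re (c r * unit_char M (r * x))) = M * b ^ card \<Lambda>"
proof -
  define a where "a = (\<lambda>r (j::int). if j = 0 then complex_of_real b
    else if j = 1 then s * c r / 2 else s * cnj (c r) / 2)"
  define \<Phi> where "\<Phi> = PiE \<Lambda> (\<lambda>_. {-1, 0, 1::int})"
  have fin: "finite \<Phi>" unfolding \<Phi>_def using assms(2) by (intro finite_PiE) auto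
  define z where "z = restrict (\<lambda>_. 0::int) \<Lambda>"
  have z: "z \<in> \<Phi>" by (auto simp: z_def \<Phi>_def)
  have factor: "complex_of_real (b + s * Re (c r * unit_char M (r * x)))
      = (\<Sum>j\<in>{-1, 0, 1}. a r j * unit_char M (j * r * x))" for r x
  proof -
    have Re_eq: "complex_of_real (b + s * Re w) = b + s * w / 2 + s * cnj w / 2" for w :: complex
      by (simp add: complex_eq_iff)
    show ?thesis unfolding Re_eq by (simp add: a_def unit_char_minus mult.assoc)
  qed
  have dvd: "int M dvd (\<Sum>r\<in>\<Lambda>. \<phi> r * r) \<longleftrightarrow> \<phi> = z" if "\<phi> \<in> \<Phi>" for \<phi>
  proof
    assume d: "int M dvd (\<Sum>r\<in>\<Lambda>. \<phi> r * r)"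
    have "\<forall>r\<in>\<Lambda>. \<phi> r \<in> {-1, 0, 1}" using that by (auto simp: \<Phi>_def)
    then have "\<forall>r\<in>\<Lambda>. \<phi> r = 0" using assms(3) d unfolding dissociated_def by blast
    then show "\<phi> = z" using that unfolding \<Phi>_def z_def by (intro extensionalityI[of _ \<Lambda>]) (auto simp: PiE_def)
  next
    assume "\<phi> = z"
    then show "int M dvd (\<Sum>r\<in>\<Lambda>. \<phi> r * r)" by (simp add: z_def)
  qed
  have "complex_of_real (\<Sum>x\<in>{0..<int M}. \<Prod>r\<in>\<Lambda>. b + s * Re (c r * unit_char M (r * x)))
      = (\<Sum>x\<in>{0..<int M}. \<Prod>r\<in>\<Lambda>. \<Sum>j\<in>{-1, 0, 1}. a r j * unit_char M (j * r * x))"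
    unfolding of_real_sum of_real_prod factor ..
  also have "\<dots> = (\<Sum>x\<in>{0..<int M}. \<Sum>\<phi>\<in>\<Phi>. \<Prod>r\<in>\<Lambda>. a r (\<phi> r) * unit_char M (\<phi> r * r * x))"
    unfolding \<Phi>_def by (intro sum.cong refl prod_sum_PiE) (use assms in auto)
  also have "\<dots> = (\<Sum>x\<in>{0..<int M}. \<Sum>\<phi>\<in>\<Phi>. (\<Prod>r\<in>\<Lambda>. a r (\<phi> r)) * unit_char M (x * (\<Sum>r\<in>\<Lambda>. \<phi> r * r)))"
    by (simp add: prod.distrib unit_char_sum[symmetric] sum_distrib_left mult_ac)
  also have "\<dots> = (\<Sum>\<phi>\<in>\<Phi>. \<Sum>x\<in>{0..<int M}. (\<Prod>r\<in>\<Lambda>. a r (\<phi> r)) * unit_char M (x * (\<Sum>r\<in>\<Lambda>. \<phi> r * r)))"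
    by (rule sum.swap)
  also have "\<dots> = (\<Sum>\<phi>\<in>\<Phi>. (\<Prod>r\<in>\<Lambda>. a r (\<phi> r)) * (\<Sum>x\<in>{0..<int M}. unit_char M (x * (\<Sum>r\<in>\<Lambda>. \<phi> r * r))))"
    by (simp only: sum_distrib_left)
  also have "\<dots> = (\<Sum>\<phi>\<in>\<Phi>. if \<phi> = z then (\<Prod>r\<in>\<Lambda>. a r (z r)) * of_nat M else 0)"
    by (intro sum.cong refl) (simp add: sum_unit_char[OF assms(1)] dvd)
  also have "\<dots> = (\<Prod>r\<in>\<Lambda>. a r (z r)) * of_nat M" using fin z by simp
  also have "(\<Prod>r\<in>\<Lambda>. a r (z r)) = complex_of_real b ^ card \<Lambda>"
    by (simp add: a_def z_def)
  finally have "complex_of_real (\<Sum>x\<in>{0..<int M}. \<Prod>r\<in>\<Lambda>. b + s * Re (c r * unit_char M (r * x)))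
      = complex_of_real (M * b ^ card \<Lambda>)" by simp
  then show ?thesis unfolding of_real_eq_iff .
qed

text \<open>
  Chang's theorem: the exponential moment of \<open>\<psi>\<close> over \<open>T\<close> is large by convexity, while over all residues it
  is at most the mean of a Riesz product.
\<close>
lemma card_dissociated_large_spectrum_le:
  assumes "M > 0" "T \<subseteq> {0..<int M}" "T \<noteq> {}" "finite \<Lambda>" "dissociated M \<Lambda>"
    and large: "\<And>r. r \<in> \<Lambda> \<Longrightarrow> norm (char_mean M T r) \<ge> 1 / 2"
  shows "real (card \<Lambda>) \<le> 16 * ln (M / card T)"
proof -
  have finT: "finite T" using assms(2) finite_subset by blast
  have cT: "real (card T) > 0" using finT assms(3) by (simp add: card_gt_0_iff)
  \<comment> \<open>Phases that turn \<open>char_mean\<close> into its modulus. Where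
    \<open>char_mean\<close> vanishes, division by zero gives \<open>c r = 0\<close>, hence only an
    inequality for the norm.\<close>
  define c where "c = (\<lambda>r. cnj (char_mean M T r) / norm (char_mean M T r))"
  have nc: "norm (c r) \<le> 1" for r by (simp add: c_def norm_divide)
  define \<psi> where "\<psi> = (\<lambda>x. \<Sum>r\<in>\<Lambda>. Re (c r * unit_char M (r * x)))"
  define m where "m = (\<Sum>t\<in>T. \<psi> t) / card T"
  have "m = (\<Sum>r\<in>\<Lambda>. Re (c r * char_mean M T r))"
  proof -
    have "(\<Sum>t\<in>T. \<psi> t) = (\<Sum>r\<in>\<Lambda>. \<Sum>t\<in>T. Re (c r * unit_char M (r * t)))"
      unfolding \<psi>_def by (rule sum.swap)
    also have "\<dots> = (\<Sum>r\<in>\<Lambda>. Re (c r * char_mean M T r) * card T)"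
    proof (intro sum.cong refl)
      fix r
      have "(\<Sum>t\<in>T. Re (c r * unit_char M (r * t))) = Re (c r * (\<Sum>t\<in>T. unit_char M (r * t)))"
        by (simp only: sum_distrib_left Re_sum)
      also have "(\<Sum>t\<in>T. unit_char M (r * t)) = char_mean M T r * of_real (card T)"
        using cT by (simp add: char_mean_def)
      finally show "(\<Sum>t\<in>T. Re (c r * unit_char M (r * t))) = Re (c r * char_mean M T r) * card T"
        by (simp only: mult.assoc[symmetric] Re_complex_of_real Im_complex_of_real times_complex.simps mult_zero_right diff_zero)
    qed
    finally show ?thesis unfolding m_def using cT by (simp add: sum_distrib_right[symmetric])
  qed
  also have "\<dots> \<ge> (\<Sum>r\<in>\<Lambda>. 1 / 2)"
  proof (intro sum_mono)
    fix r assume "r \<in> \<Lambda>"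
    then have n: "norm (char_mean M T r) \<ge> 1 / 2" by (rule large)
    have "c r * char_mean M T r = of_real ((norm (char_mean M T r))\<^sup>2 / norm (char_mean M T r))"
      unfolding c_def by (simp only: of_real_divide complex_norm_square) (simp add: mult.commute)
    also have "\<dots> = of_real (norm (char_mean M T r))" using n by (simp add: power2_eq_square)
    finally show "1 / 2 \<le> Re (c r * char_mean M T r)" using n by simp
  qed
  finally have m: "m \<ge> card \<Lambda> / 2" by simp
  \<comment> \<open>The scale \<open>1 / 4\<close> leaves a net gain: each frequency contributes at
    least \<open>1 / 8\<close> to \<open>m / 4\<close> and costs at most \<open>1 / 16\<close> in
    the Riesz product.\<close>
  have "(\<Sum>t\<in>T. exp (\<psi> t / 4)) \<le> (\<Sum>x\<in>{0..<int M}. exp (\<psi> x / 4))"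
    using assms(2) by (intro sum_mono2) auto
  also have "\<dots> \<le> (\<Sum>x\<in>{0..<int M}. \<Prod>r\<in>\<Lambda>. 17 / 16 + 1 / 4 * Re (c r * unit_char M (r * x)))"
  proof (intro sum_mono)
    fix x
    have "exp (\<psi> x / 4) = (\<Prod>r\<in>\<Lambda>. exp (Re (c r * unit_char M (r * x)) / 4))"
      by (simp add: \<psi>_def sum_divide_distrib exp_sum[OF assms(4)])
    also have "\<dots> \<le> (\<Prod>r\<in>\<Lambda>. 17 / 16 + 1 / 4 * Re (c r * unit_char M (r * x)))"
    proof (intro prod_mono conjI)
      fix r
      define y where "y = Re (c r * unit_char M (r * x))"
      have y: "\<bar>y\<bar> \<le> 1"
        using abs_Re_le_cmod[of "c r * unit_char M (r * x)"] nc[of r] by (simp add: norm_mult y_def)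
      have "exp (y / 4) \<le> 1 + y / 4 + (y / 4)\<^sup>2" using y by (intro exp_le_quadratic) auto
      also have "(y / 4)\<^sup>2 \<le> 1 / 16" using y by (simp add: power_divide abs_square_le_1)
      finally show "exp (y / 4) \<le> 17 / 16 + 1 / 4 * y" by simp
    qed auto
    finally show "exp (\<psi> x / 4) \<le> (\<Prod>r\<in>\<Lambda>. 17 / 16 + 1 / 4 * Re (c r * unit_char M (r * x)))" .
  qed
  also have "\<dots> = M * (17 / 16) ^ card \<Lambda>" by (rule sum_riesz_product[OF assms(1,4,5)])
  also have "\<dots> \<le> M * exp (1 / 16) ^ card \<Lambda>"
    using exp_ge_add_one_self[of "1/16"] by (intro mult_left_mono power_mono) auto
  also have "\<dots> = M * exp (card \<Lambda> / 16)" by (simp add: exp_of_nat_mult[symmetric])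
  finally have upper: "(\<Sum>t\<in>T. exp (\<psi> t / 4)) \<le> M * exp (card \<Lambda> / 16)" .
  \<comment> \<open>Jensen's inequality via the tangent of \<open>exp\<close> at the mean; the
    linear terms cancel over \<open>T\<close>.\<close>
  have "card T = (\<Sum>t\<in>T. 1 + (\<psi> t - m) / 4)"
    using cT by (simp add: sum.distrib sum_divide_distrib[symmetric] sum_subtractf m_def)
  also have "\<dots> \<le> (\<Sum>t\<in>T. exp ((\<psi> t - m) / 4))"
    by (intro sum_mono) (use exp_ge_add_one_self in auto)
  also have "\<dots> = exp (- m / 4) * (\<Sum>t\<in>T. exp (\<psi> t / 4))"
    by (simp add: sum_distrib_left exp_add[symmetric] diff_divide_distrib)
  also have "\<dots> \<le> exp (- m / 4) * (M * exp (card \<Lambda> / 16))"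
    by (intro mult_left_mono upper) auto
  also have "\<dots> = M * exp (card \<Lambda> / 16 - m / 4)" by (simp add: mult.left_commute mult_exp_exp)
  also have "\<dots> \<le> M * exp (- (card \<Lambda> / 16))" using m by (intro mult_left_mono) auto
  finally have "exp (card \<Lambda> / 16) \<le> M / card T"
    using cT by (simp add: exp_minus field_simps)
  then have "card \<Lambda> / 16 \<le> ln (M / card T)"
    using cT assms(1) by (subst ln_ge_iff) auto
  then show ?thesis by simp
qed

text \<open>Choose \<open>\<Lambda>\<close> of largest size. Adjoining a further \<open>r\<close>
  creates a nontrivial relation, in which \<open>r\<close> has a nonzero coefficient since
  \<open>\<Lambda>\<close> is dissociated. This coefficient is 1 or -1, so the relation can be
  solved for \<open>r\<close>.\<close>

lemma dissociated_spanning_subset: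
  assumes "finite S"
  obtains \<Lambda> where "\<Lambda> \<subseteq> S" "dissociated M \<Lambda>"
    "\<And>r. r \<in> S \<Longrightarrow> \<exists>\<phi>. (\<forall>l\<in>\<Lambda>. \<phi> l \<in> {-1, 0, 1}) \<and> int M dvd r - (\<Sum>l\<in>\<Lambda>. \<phi> l * l)"
proof -
  define P where "P = (\<lambda>\<Lambda>. \<Lambda> \<subseteq> S \<and> dissociated M \<Lambda>)"
  have "P {}" by (simp add: P_def dissociated_def)
  moreover have "\<forall>\<Lambda>. P \<Lambda> \<longrightarrow> card \<Lambda> < Suc (card S)"
    using assms by (auto simp: P_def less_Suc_eq_le intro: card_mono)
  ultimately have "\<exists>\<Lambda>. P \<Lambda> \<and> (\<forall>\<Lambda>'. P \<Lambda>' \<longrightarrow> card \<Lambda>' \<le> card \<Lambda>)"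
    by (rule ex_has_greatest_nat)
  then obtain \<Lambda> where \<Lambda>: "P \<Lambda>" "\<And>\<Lambda>'. P \<Lambda>' \<Longrightarrow> card \<Lambda>' \<le> card \<Lambda>"
    by blast
  have fin: "finite \<Lambda>" using \<Lambda>(1) assms finite_subset by (auto simp: P_def)
  have span: "\<exists>\<phi>. (\<forall>l\<in>\<Lambda>. \<phi> l \<in> {-1, 0, 1}) \<and> int M dvd r - (\<Sum>l\<in>\<Lambda>. \<phi> l * l)" if r: "r \<in> S" for r
  proof (cases "r \<in> \<Lambda>")
    case True
    have "(\<Sum>l\<in>\<Lambda>. (if l = r then 1 else 0) * l) = (\<Sum>l\<in>\<Lambda>. if l = r then r else 0)"
      by (intro sum.cong) auto
    then show ?thesis using True fin by (intro exI[of _ "\<lambda>l. if l = r then 1 else 0"]) simp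
  next
    case False
    have "\<not> P (insert r \<Lambda>)" using \<Lambda>(2)[of "insert r \<Lambda>"] False fin by auto
    then have "\<not> dissociated M (insert r \<Lambda>)" using \<Lambda>(1) r by (simp add: P_def)
    then obtain \<phi> where \<phi>: "\<forall>l\<in>insert r \<Lambda>. \<phi> l \<in> {-1, 0, 1}"
      "int M dvd (\<Sum>l\<in>insert r \<Lambda>. \<phi> l * l)" "\<not> (\<forall>l\<in>insert r \<Lambda>. \<phi> l = 0)"
      unfolding dissociated_def by blast
    have d: "int M dvd \<phi> r * r + (\<Sum>l\<in>\<Lambda>. \<phi> l * l)" using \<phi>(2) False fin by simp
    have "\<phi> r \<noteq> 0"
    proof
      assume 0: "\<phi> r = 0"
      then have "\<forall>l\<in>\<Lambda>. \<phi> l = 0" using \<Lambda>(1) \<phi>(1) d unfolding P_def dissociated_def by simp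
      then show False using 0 \<phi>(3) by simp
    qed
    then consider "\<phi> r = 1" | "\<phi> r = -1" using \<phi>(1) by auto
    then show ?thesis
    proof cases
      case 1
      then show ?thesis using \<phi>(1) d by (intro exI[of _ "\<lambda>l. - \<phi> l"]) (auto simp: sum_negf)
    next
      case 2
      then have "int M dvd - (\<phi> r * r + (\<Sum>l\<in>\<Lambda>. \<phi> l * l))" using d by (simp only: dvd_minus_iff)
      then show ?thesis using \<phi>(1) 2 by (intro exI[of _ \<phi>]) auto
    qed
  qed
  have "\<Lambda> \<subseteq> S" "dissociated M \<Lambda>" using \<Lambda>(1) by (simp_all add: P_def)
  then show thesis by (rule that) (rule span)
qed

lemma norm_cis_minus_1_le: "norm (cis x - 1) \<le> \<bar>x\<bar>"
  using dist_exp_i_1[of x] abs_sin_x_le_abs_x[of "x / 2"] by (simp add: cis_conv_exp)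

text \<open>
  Dirichlet's theorem applied to a dissociated spanning subset controls the whole large spectrum,
  at the cost of a factor \<open>d\<close>.
\<close>
lemma common_difference_small_on_large_spectrum:
  assumes "M > 0" "T \<subseteq> {0..<int M}" "T \<noteq> {}" "16 * ln (M / card T) \<le> real d" "Q > 0"
  obtains D where "0 < D" "D \<le> int (Q ^ d)"
    "\<And>r j. r \<in> {0..<int M} \<Longrightarrow> norm (char_mean M T r) \<ge> 1 / 2 \<Longrightarrow>
       norm (unit_char M (r * (int j * D)) - 1) \<le> 2 * pi * d * j / Q"
proof -
  define S where "S = {r\<in>{0..<int M}. norm (char_mean M T r) \<ge> 1 / 2}"
  have "finite S" unfolding S_def by (rule finite_subset[of _ "{0..<int M}"]) auto
  then obtain \<Lambda> where \<Lambda>: "\<Lambda> \<subseteq> S" "dissociated M \<Lambda>"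
    "\<And>r. r \<in> S \<Longrightarrow> \<exists>\<phi>. (\<forall>l\<in>\<Lambda>. \<phi> l \<in> {-1, 0, 1}) \<and> int M dvd r - (\<Sum>l\<in>\<Lambda>. \<phi> l * l)"
    using dissociated_spanning_subset[of S M] by blast
  have fin: "finite \<Lambda>" using \<Lambda>(1) \<open>finite S\<close> finite_subset by blast
  have "real (card \<Lambda>) \<le> 16 * ln (M / card T)"
    by (rule card_dissociated_large_spectrum_le[OF assms(1-3) fin \<Lambda>(2)]) (use \<Lambda>(1) S_def in auto)
  then have cd: "card \<Lambda> \<le> d" using assms(4) by linarith
  obtain h where h: "bij_betw h {0..<card \<Lambda>} \<Lambda>" using ex_bij_betw_nat_finite[OF fin] by blast
  obtain D p where D: "0 < D" "D \<le> int (Q ^ card \<Lambda>)"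
    "\<And>i. i < card \<Lambda> \<Longrightarrow> \<bar>of_int D * (real_of_int (h i) / M) - of_int (p i)\<bar> < 1 / Q"
    using Dirichlet_approx_simult[OF assms(5), where \<theta> = "\<lambda>i. real_of_int (h i) / M" and n = "card \<Lambda>"] by blast
  have "\<exists>q::int. \<bar>real_of_int D * (l / M) - q\<bar> \<le> 1 / Q" if l: "l \<in> \<Lambda>" for l
  proof -
    obtain i where "i < card \<Lambda>" "h i = l" using h l unfolding bij_betw_def by (metis imageE atLeastLessThan_iff)
    then show ?thesis using D(3)[of i] by (intro exI[of _ "p i"]) auto
  qed
  then obtain q :: "int \<Rightarrow> int" where q: "\<And>l. l \<in> \<Lambda> \<Longrightarrow> \<bar>real_of_int D * (l / M) - q l\<bar> \<le> 1 / Q"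
    by metis
  have D_le: "D \<le> int (Q ^ d)"
  proof -
    have "Q ^ card \<Lambda> \<le> Q ^ d" using assms(5) cd by (intro power_increasing) auto
    then show ?thesis using D(2) by linarith
  qed
  have small: "norm (unit_char M (r * (int j * D)) - 1) \<le> 2 * pi * d * j / Q"
    if r: "r \<in> {0..<int M}" "norm (char_mean M T r) \<ge> 1 / 2" for r j
  proof -
    have "r \<in> S" using r by (simp add: S_def)
    then obtain \<phi> where \<phi>: "\<forall>l\<in>\<Lambda>. \<phi> l \<in> {-1, 0, 1}" "int M dvd r - (\<Sum>l\<in>\<Lambda>. \<phi> l * l)"
      using \<Lambda>(3) by blast
    \<comment> \<open>The phase is split as \<open>\<theta> + n\<close>: \<open>\<theta>\<close>
      collects the Diophantine errors, and \<open>n\<close> the approximating integers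
      \<open>q l\<close>, which the character ignores.\<close>
    define \<theta> where "\<theta> = (\<Sum>l\<in>\<Lambda>. real_of_int (\<phi> l) * j * (D * (l / M) - q l))"
    define n where "n = (\<Sum>l\<in>\<Lambda>. \<phi> l * int j * q l)"
    have "int M dvd (r - (\<Sum>l\<in>\<Lambda>. \<phi> l * l)) * (int j * D)" using \<phi>(2) by (rule dvd_mult2)
    then have "unit_char M (r * (int j * D)) = unit_char M ((\<Sum>l\<in>\<Lambda>. \<phi> l * l) * (int j * D))"
      by (intro unit_char_cong assms(1)) (simp add: left_diff_distrib)
    also have "2 * pi * of_int ((\<Sum>l\<in>\<Lambda>. \<phi> l * l) * (int j * D)) / of_nat M = 2 * pi * \<theta> + 2 * pi * n"
    proof -
      have "of_int ((\<Sum>l\<in>\<Lambda>. \<phi> l * l) * (int j * D)) / real M = \<theta> + n"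
        unfolding \<theta>_def n_def of_int_sum of_int_mult sum_distrib_right sum_divide_distrib sum.distrib[symmetric]
        by (intro sum.cong refl) (simp add: algebra_simps)
      then show ?thesis by (simp only: times_divide_eq_right[symmetric] distrib_left[symmetric])
    qed
    then have "unit_char M ((\<Sum>l\<in>\<Lambda>. \<phi> l * l) * (int j * D)) = cis (2 * pi * \<theta>)"
      unfolding unit_char_def by (simp only: cis_mult[symmetric] cis_multiple_2pi Ints_of_int mult_1_right)
    finally have "norm (unit_char M (r * (int j * D)) - 1) \<le> \<bar>2 * pi * \<theta>\<bar>"
      by (simp only: norm_cis_minus_1_le)
    also have "\<dots> = 2 * pi * \<bar>\<theta>\<bar>" by (simp add: abs_mult)
    also have "\<bar>\<theta>\<bar> \<le> (\<Sum>l\<in>\<Lambda>. j / Q)"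
      unfolding \<theta>_def
    proof (rule order_trans[OF sum_abs sum_mono])
      fix l assume l: "l \<in> \<Lambda>"
      have "\<bar>real_of_int (\<phi> l)\<bar> \<le> 1" using \<phi>(1) l by auto
      then have a: "\<bar>real_of_int (\<phi> l)\<bar> * real j \<le> 1 * real j" by (intro mult_right_mono) auto
      have "\<bar>real_of_int (\<phi> l)\<bar> * real j * \<bar>D * (l / M) - q l\<bar> \<le> 1 * real j * (1 / Q)"
        by (rule mult_mono[OF a q[OF l]]) auto
      then show "\<bar>real_of_int (\<phi> l) * j * (D * (l / M) - q l)\<bar> \<le> j / Q" by (simp add: abs_mult)
    qed
    also have "\<dots> \<le> d * (j / Q)" using cd by (simp add: mult_right_mono divide_right_mono)
    finally show ?thesis by (simp add: mult_left_mono mult.assoc)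
  qed
  show thesis by (rule that[OF D(1) D_le]) (rule small)
qed

section \<open>Progressions in sumsets\<close>

text \<open>By \<open>2ab \<le> a^2 + b^2\<close> and Parseval the sum is at most the mean of 1 and
  \<open>M / card A\<close>, and the latter is at least 1. This absolute sum turns bounds for single
  frequencies into uniform bounds for \<open>F\<close>.\<close>

lemma sum_norm_convolution_coefficients_le:
  fixes s :: "int \<Rightarrow> real"
  assumes "M > 0" "A \<subseteq> {0..<int M}" "A \<noteq> {}" "\<And>x. 0 \<le> s x" "\<And>x. s x \<le> 1"
  shows "(\<Sum>r\<in>{0..<int M}. norm (fourier_coeff M s r * char_mean M A r))
    \<le> M / card A"
proof -
  have finA: "finite A" using assms(2) finite_subset by blast
  have cA: "real (card A) > 0" using finA assms(3) by (simp add: card_gt_0_iff)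
  have "card A \<le> M" using card_mono[OF _ assms(2)] by simp
  then have W: "M / card A \<ge> 1" using cA by (simp add: field_simps)
  define sh where "sh = fourier_coeff M s"
  have "norm (sh r) = norm (\<Sum>y\<in>{0..<int M}. (s y / M) * unit_char M (r * y))" for r
  proof -
    have "sh r = cnj (\<Sum>y\<in>{0..<int M}. (s y / M) * unit_char M (r * y))"
      by (simp add: sh_def fourier_coeff_def unit_char_minus)
    then show ?thesis by (simp only: complex_mod_cnj)
  qed
  then have "(\<Sum>r\<in>{0..<int M}. (norm (sh r))\<^sup>2) = M * (\<Sum>y\<in>{0..<int M}. (s y / M)\<^sup>2)"
    using parseval[OF assms(1), of "{0..<int M}" "\<lambda>y. s y / M"] by simp
  also have "\<dots> \<le> M * (\<Sum>y\<in>{0..<int M}. (1 / M)\<^sup>2)"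
    using assms(4,5) by (intro mult_left_mono sum_mono power_mono divide_right_mono) auto
  also have "\<dots> = 1" using assms(1) by (simp add: power2_eq_square)
  finally have S: "(\<Sum>r\<in>{0..<int M}. (norm (sh r))\<^sup>2) \<le> 1" .
  have "char_mean M A r = (\<Sum>y\<in>A. (1 / card A) * unit_char M (r * y))" for r
    by (simp add: char_mean_def sum_divide_distrib)
  then have "(\<Sum>r\<in>{0..<int M}. (norm (char_mean M A r))\<^sup>2) = M * (\<Sum>y\<in>A. (1 / card A)\<^sup>2)"
    using parseval[OF assms(1,2), of "\<lambda>_. 1 / card A"] by simp
  also have "\<dots> = M / card A" using cA by (simp add: power2_eq_square)
  finally have T: "(\<Sum>r\<in>{0..<int M}. (norm (char_mean M A r))\<^sup>2) = M / card A" .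
  have "(\<Sum>r\<in>{0..<int M}. norm (sh r * char_mean M A r))
      \<le> (\<Sum>r\<in>{0..<int M}. ((norm (sh r))\<^sup>2 + (norm (char_mean M A r))\<^sup>2) / 2)"
  proof (intro sum_mono)
    fix r
    show "norm (sh r * char_mean M A r) \<le> ((norm (sh r))\<^sup>2 + (norm (char_mean M A r))\<^sup>2) / 2"
      using sum_squares_bound[of "norm (sh r)" "norm (char_mean M A r)"] by (simp add: norm_mult)
  qed
  also have "\<dots> \<le> (1 + M / card A) / 2"
    using S T by (simp add: sum_divide_distrib[symmetric] sum.distrib)
  also have "\<dots> \<le> M / card A"
  proof -
    have "(1 + w) / 2 \<le> w" if "1 \<le> w" for w :: real using that by simp
    then show ?thesis using W .
  qed
  finally show ?thesis by (simp add: sh_def)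
qed

text \<open>
  Here \<open>l\<close> is the number of smoothing steps, \<open>k\<close> the sample size, \<open>d\<close> a bound for the dimension of the large
  spectrum of the almost periods, and \<open>Q\<close> the quality of the Diophantine approximation.
  The modulus \<open>4 N\<close> leaves enough room for all sums that occur not to wrap around.
\<close>
lemma arith_prog_in_sum_diff_parametric:
  fixes A :: "int set" and N L l k d Q :: nat
  assumes "N > 0" "A \<subseteq> {1..int N}" "A \<noteq> {}" "l > 0" "32 * l \<le> k" "Q > 0"
    and l: "64 * real N / card A \<le> 4 ^ l"
    and d: "16 * ln (8 * (2 * real N / card A) ^ k) \<le> d"
    and Q: "256 * real d * L * N / card A \<le> Q"
    and k: "256 * real l * L * N / card A * exp (- real k / (1024 * (real l)\<^sup>2)) < 1"
    and H: "L * Q ^ d \<le> N"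
  shows "\<exists>y D. D > 0 \<and> (\<forall>j<L. \<exists>a\<in>A. \<exists>b\<in>A. \<exists>c\<in>A. y + int j * D = a + b - c)"
proof -
  have finA: "finite A" using assms(2) finite_subset by blast
  have cA: "real (card A) > 0" using finA assms(3) by (simp add: card_gt_0_iff)
  define M where "M = 4 * N"
  have M: "M > 0" using assms(1) by (simp add: M_def)
  define W where "W = M / card A"
  have W: "W > 0" using M cA by (simp add: W_def)
  have AM: "A \<subseteq> {0..<int M}" using assms(1,2) by (fastforce simp: M_def)
  define S where "S = (\<lambda>(a, b). a + b) ` (A \<times> A)"
  define s where "s = (\<lambda>x. of_bool (x mod int M \<in> S) :: real)"
  have pers: "mod_periodic M s" by (simp add: mod_periodic_def s_def)
  have s01: "0 \<le> s x" "s x \<le> 1" for x by (auto simp: s_def)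
  have mod_id: "x mod int M = x" if "0 \<le> x" "x < 4 * int N" for x
    using that by (simp add: M_def)
  define f where "f = (\<lambda>y. (\<Sum>a\<in>A. s (y + a)) / card A)"
  \<comment> \<open>Each of the \<open>l\<close> smoothing steps raises the truncation height by
    \<open>2 * e\<close>, in total by \<open>1 / 8\<close>.\<close>
  define e where "e = 1 / (16 * real l)"
  have e: "0 < e" "e \<le> 1" "e * k \<ge> 2" using assms(4,5) by (auto simp: e_def field_simps)
  obtain T where T: "T \<subseteq> {1..int N}"
    "real (card T) * (2 * (2 * real N) ^ k) \<ge> real N * real (card A) ^ k"
    "\<And>t t'. t \<in> T \<Longrightarrow> t' \<in> T \<Longrightarrow>
       excess M (2 * e) (\<lambda>y. f (y + t - t') - f y) \<le> 8 * real M * exp (- e\<^sup>2 * k / 4)"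
    using almost_periods_exist[OF M assms(1-3) pers s01 e] unfolding f_def by blast
  have finT: "finite T" using T(1) finite_subset by blast
  have "0 < real N * real (card A) ^ k" using assms(1) cA by simp
  also note T(2)
  finally have cT: "real (card T) > 0" by (simp add: zero_less_mult_iff)
  then have Tne: "T \<noteq> {}" by auto
  have TM: "T \<subseteq> {0..<int M}" using assms(1) T(1) by (fastforce simp: M_def)
  have "M / card T \<le> 8 * (2 * real N / card A) ^ k"
    using T(2) cT cA by (simp add: M_def field_simps power_divide)
  then have "16 * ln (M / card T) \<le> 16 * ln (8 * (2 * real N / card A) ^ k)"
    using cT M by (intro mult_left_mono ln_mono) auto
  then have "16 * ln (M / card T) \<le> d" using d by linarith
  then obtain D where D: "0 < D" "D \<le> int (Q ^ d)"
    "\<And>r j. r \<in> {0..<int M} \<Longrightarrow> norm (char_mean M T r) \<ge> 1 / 2 \<Longrightarrow>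
       norm (unit_char M (r * (int j * D)) - 1) \<le> 2 * pi * d * j / Q"
    using common_difference_small_on_large_spectrum[OF M TM Tne _ assms(6)] by blast
  define F where "F = (smooth T ^^ l) f"
  have perf: "mod_periodic M f"
    unfolding f_def by (rule mod_periodic_sum_shifts[OF pers])
  have "mod_periodic M ((smooth T ^^ i) f)" for i
    by (induction i) (use perf mod_periodic_smooth in auto)
  then have perF: "mod_periodic M F" by (simp add: F_def)
  define Bad where "Bad = {x\<in>{0..<int M}. \<bar>F x - f x\<bar> > 2 * (1 / 8)}"
  have finBad: "finite Bad" unfolding Bad_def by (rule finite_subset[of _ "{0..<int M}"]) auto
  have "real (card Bad) * (1 / 8) \<le> excess M (1 / 8) (\<lambda>x. F x - f x)"
    unfolding Bad_def by (rule card_exceed_le) simp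
  moreover have "excess M (l * (2 * e)) (\<lambda>x. F x - f x) \<le> l * (8 * real M * exp (- e\<^sup>2 * k / 4))"
    unfolding F_def by (rule excess_funpow_smooth_le[OF M perf finT Tne T(3)])
  moreover have "l * (2 * e) = 1 / 8" using assms(4) by (simp add: e_def)
  moreover have "- e\<^sup>2 * k / 4 = - real k / (1024 * (real l)\<^sup>2)"
    by (simp add: e_def power2_eq_square field_simps)
  ultimately have "real (card Bad) \<le> 64 * l * M * exp (- real k / (1024 * (real l)\<^sup>2))" by simp
  then have "L * real (card Bad) \<le> L * (64 * l * M * exp (- real k / (1024 * (real l)\<^sup>2)))"
    by (intro mult_left_mono) auto
  also have "\<dots> < card A" using k cA by (simp add: M_def field_simps)
  finally have cBad: "real (L * card Bad) < real (card A)" by simp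
  \<comment> \<open>Union bound over \<open>j\<close>: translation by \<open>j * D\<close> is
    injective modulo \<open>M\<close>, so each \<open>j\<close> excludes at most
    \<open>card Bad\<close> elements of \<open>A\<close>.\<close>
  have "\<exists>y\<in>A. \<forall>j<L. (y + int j * D) mod int M \<notin> Bad"
  proof (rule ccontr)
    assume "\<not> ?thesis"
    then have "A \<subseteq> (\<Union>j<L. {y\<in>A. (y + int j * D) mod int M \<in> Bad})" by blast
    then have "card A \<le> card (\<Union>j<L. {y\<in>A. (y + int j * D) mod int M \<in> Bad})"
      by (rule card_mono[rotated]) (use finA in auto)
    also have "\<dots> \<le> (\<Sum>j<L. card {y\<in>A. (y + int j * D) mod int M \<in> Bad})"
      by (rule card_UN_le) simp
    also have "\<dots> \<le> (\<Sum>j<L. card Bad)"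
    proof (intro sum_mono card_inj_on_le[OF _ _ finBad])
      fix j
      show "inj_on (\<lambda>y. (y + int j * D) mod int M) {y\<in>A. (y + int j * D) mod int M \<in> Bad}"
        by (rule inj_on_subset[OF bij_betw_imp_inj_on[OF bij_betw_shift_mod[OF M]]]) (use AM in auto)
    qed auto
    finally show False using cBad by (simp flip: of_nat_mult)
  qed
  then obtain y where y: "y \<in> A" "\<And>j. j < L \<Longrightarrow> (y + int j * D) mod int M \<notin> Bad" by blast
  have close: "\<bar>F (y + int j * D) - f (y + int j * D)\<bar> \<le> 1 / 4" if "j < L" for j
    using y(2)[OF that] M perf perF by (simp add: Bad_def mod_periodic_def)
  define c where "c = (\<lambda>r. fourier_coeff M s r * char_mean M A r)"
  have sumc: "(\<Sum>r\<in>{0..<int M}. norm (c r)) \<le> W"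
    unfolding c_def W_def by (rule sum_norm_convolution_coefficients_le[OF M AM assms(3) s01])
  have "complex_of_real (f x) = (\<Sum>r\<in>{0..<int M}. c r * unit_char M (r * x))" for x
  proof -
    have "complex_of_real (f x) = (\<Sum>a\<in>A. complex_of_real (s (x + a))) / card A"
      by (simp add: f_def)
    also have "\<dots> = (\<Sum>a\<in>A. \<Sum>r\<in>{0..<int M}. fourier_coeff M s r * unit_char M (r * (x + a))) / card A"
      by (simp only: fourier_inversion[OF M pers])
    also have "\<dots> = (\<Sum>r\<in>{0..<int M}. \<Sum>a\<in>A. fourier_coeff M s r * unit_char M (r * (x + a))) / card A"
      by (rule arg_cong2[where f = "(/)", OF sum.swap refl])
    also have "\<dots> = (\<Sum>r\<in>{0..<int M}. c r * unit_char M (r * x))"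
      unfolding sum_divide_distrib
    proof (intro sum.cong refl)
      fix r
      have "(\<Sum>a\<in>A. fourier_coeff M s r * unit_char M (r * (x + a)) / card A)
          = fourier_coeff M s r * ((\<Sum>a\<in>A. unit_char M (r * a)) / card A) * unit_char M (r * x)"
        by (simp add: sum_distrib_left sum_distrib_right sum_divide_distrib distrib_left unit_char_add mult_ac)
      then show "(\<Sum>a\<in>A. fourier_coeff M s r * unit_char M (r * (x + a)) / card A) = c r * unit_char M (r * x)"
        by (simp add: c_def char_mean_def)
    qed
    finally show ?thesis .
  qed
  from funpow_smooth_fourier[OF this, where T = T and l = l]
  have Fexp: "complex_of_real (F x)
      = (\<Sum>r\<in>{0..<int M}. c r * of_real (norm (char_mean M T r) ^ (2 * l)) * unit_char M (r * x))" for x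
    unfolding F_def .
  have smooth_close: "\<bar>F (y + int j * D) - F y\<bar> \<le> 1 / 8" if jL: "j < L" for j
  proof -
    \<comment> \<open>Off the large spectrum the power \<open>2 * l\<close> makes the multiplier
      tiny, while the character difference is at most 2. On it the multiplier is at most 1, and the
      choice of \<open>D\<close> makes the difference small.\<close>
    have factor: "norm (char_mean M T r) ^ (2 * l) * norm (unit_char M (r * (int j * D)) - 1) \<le> 1 / (8 * W)"
      if r: "r \<in> {0..<int M}" for r
    proof (cases "norm (char_mean M T r) \<ge> 1 / 2")
      case False
      have "norm (char_mean M T r) ^ (2 * l) \<le> (1 / 2) ^ (2 * l)"
        using False by (intro power_mono) auto
      also have "\<dots> = 1 / 4 ^ l" by (simp add: power_mult power_divide)
      also have "\<dots> \<le> 1 / (16 * W)"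
        using l W cA assms(1) by (intro divide_left_mono) (auto simp: W_def M_def)
      finally have "norm (char_mean M T r) ^ (2 * l) * norm (unit_char M (r * (int j * D)) - 1) \<le> 1 / (16 * W) * 2"
        using norm_triangle_ineq4[of "unit_char M (r * (int j * D))" 1] W by (intro mult_mono) auto
      then show ?thesis using W by simp
    next
      case True
      have "norm (unit_char M (r * (int j * D)) - 1) \<le> 2 * pi * d * j / Q"
        using D(3)[OF r True] .
      also have "\<dots> \<le> 2 * 4 * real d * real L / Q"
        using jL pi_less_4 by (intro divide_right_mono mult_mono) auto
      also have "\<dots> \<le> 1 / (8 * W)"
        using Q W assms(6) cA by (simp add: field_simps W_def M_def)
      finally have "norm (unit_char M (r * (int j * D)) - 1) \<le> 1 / (8 * W)" .
      moreover have "norm (char_mean M T r) ^ (2 * l) \<le> 1"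
        using norm_char_mean_le_1 by (intro power_le_one) auto
      ultimately have "norm (char_mean M T r) ^ (2 * l) * norm (unit_char M (r * (int j * D)) - 1) \<le> 1 * (1 / (8 * W))"
        by (intro mult_mono) auto
      then show ?thesis by simp
    qed
    have "complex_of_real (F (y + int j * D) - F y)
        = (\<Sum>r\<in>{0..<int M}. c r * of_real (norm (char_mean M T r) ^ (2 * l))
            * unit_char M (r * y) * (unit_char M (r * (int j * D)) - 1))"
      unfolding of_real_diff Fexp sum_subtractf[symmetric]
      by (intro sum.cong refl) (simp add: unit_char_add algebra_simps)
    then have "\<bar>F (y + int j * D) - F y\<bar> = norm (\<Sum>r\<in>{0..<int M}. c r * of_real (norm (char_mean M T r) ^ (2 * l))
            * unit_char M (r * y) * (unit_char M (r * (int j * D)) - 1))"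
      by (metis norm_of_real)
    also have "\<dots> \<le> (\<Sum>r\<in>{0..<int M}. norm (c r) * (1 / (8 * W)))"
    proof (rule order_trans[OF norm_sum sum_mono])
      fix r assume r: "r \<in> {0..<int M}"
      show "norm (c r * of_real (norm (char_mean M T r) ^ (2 * l)) * unit_char M (r * y)
          * (unit_char M (r * (int j * D)) - 1)) \<le> norm (c r) * (1 / (8 * W))"
        using mult_left_mono[OF factor[OF r], of "norm (c r)"]
        by (simp add: norm_mult norm_power mult.assoc)
    qed
    also have "\<dots> \<le> W * (1 / (8 * W))"
      unfolding sum_distrib_right[symmetric] using sumc W by (intro mult_right_mono) auto
    finally show ?thesis using W by simp
  qed
  have "\<exists>a\<in>A. \<exists>b\<in>A. \<exists>c\<in>A. y + int j * D = a + b - c" if j: "j < L" for j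
  proof -
    \<comment> \<open>Since \<open>y \<in> A\<close>, every \<open>y + a\<close> lies in
      \<open>S\<close>. Starting from the value 1, two approximation errors of \<open>1 / 4\<close>
      and a drift of \<open>1 / 8\<close> still leave \<open>f\<close> at least \<open>3 / 8\<close>
      along the progression.\<close>
    have "f y = 1"
    proof -
      have "s (y + a) = 1" if "a \<in> A" for a
      proof -
        have "1 \<le> y" "y \<le> int N" "1 \<le> a" "a \<le> int N" using assms(2) y(1) that by auto
        then have "(y + a) mod int M = y + a" by (intro mod_id) auto
        then show ?thesis using y(1) that by (force simp: s_def S_def)
      qed
      then show ?thesis using cA by (simp add: f_def)
    qed
    moreover have "0 < L" using j by simp
    ultimately have "F y \<ge> 3 / 4" using close[of 0] by (simp add: abs_if split: if_splits)
    then have "f (y + int j * D) > 0"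
      using smooth_close[OF j] close[OF j] by linarith
    then have "(\<Sum>a\<in>A. s (y + int j * D + a)) > 0" using cA by (simp add: f_def zero_less_divide_iff)
    then obtain a where a: "a \<in> A" "s (y + int j * D + a) > 0"
      by (meson not_less sum_nonpos)
    then have "(y + int j * D + a) mod int M \<in> S" by (auto simp: s_def split: if_splits)
    \<comment> \<open>No wrap-around: \<open>y\<close>, \<open>j * D\<close> and \<open>a\<close>
      are each at most \<open>N\<close>, while the modulus is \<open>4 * N\<close>.\<close>
    moreover have "(y + int j * D + a) mod int M = y + int j * D + a"
    proof (rule mod_id)
      have b: "1 \<le> y" "y \<le> int N" "1 \<le> a" "a \<le> int N" using assms(2) y(1) a(1) by auto
      have "int j * D \<le> int L * int (Q ^ d)" using j D(1,2) by (intro mult_mono) auto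
      also have "\<dots> = int (L * Q ^ d)" by simp
      also have "\<dots> \<le> int N" using H by (rule of_nat_mono)
      finally have "int j * D \<le> int N" .
      moreover have "0 \<le> int j * D" using D(1) by simp
      ultimately show "0 \<le> y + int j * D + a" "y + int j * D + a < 4 * int N"
        using b assms(1) by linarith+
    qed
    ultimately obtain b c where "b \<in> A" "c \<in> A" "y + int j * D + a = b + c" by (auto simp: S_def)
    then show ?thesis using a(1) by (metis add_diff_cancel_right')
  qed
  then show ?thesis using D(1) by blast
qed

section \<open>Choice of the parameters\<close>

text \<open>Serves to absorb numerical constants into exponentials of \<open>\<mu>\<close>.\<close>

lemma two_power_le_exp:
  fixes x \<mu> :: real
  assumes "ln 2 \<le> \<mu>" "x \<le> 2 ^ n"
  shows "x \<le> exp (n * \<mu>)"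
proof -
  have "2 \<le> exp \<mu>" using assms(1) exp_le_cancel_iff[of "ln 2" \<mu>] by simp
  then have "2 ^ n \<le> exp \<mu> ^ n" by (intro power_mono) auto
  with assms(2) have "x \<le> exp \<mu> ^ n" by linarith
  then show ?thesis by (simp add: exp_of_nat_mult)
qed

lemma real_nat_ceiling_le:
  fixes x :: real
  assumes "0 \<le> x"
  shows "real (nat \<lceil>x\<rceil>) \<le> x + 1"
  using assms of_int_ceiling_le_add_one[of x] by simp

text \<open>With \<open>\<kappa> = ln (2 / \<alpha>)\<close> and
  \<open>\<mu> = \<kappa> + ln L\<close>, the parameters \<open>l\<close>, \<open>k\<close>,
  \<open>d\<close> and \<open>ln Q\<close> are at most of order \<open>\<kappa>\<close>,
  \<open>\<kappa>^2 \<mu>\<close>, \<open>\<kappa>^3 \<mu>\<close> and \<open>\<mu>\<close>. So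
  \<open>ln (L * Q ^ d)\<close> is at most of order \<open>\<kappa>^3 \<mu>^2\<close>, which
  \<open>big\<close> compares with \<open>ln N\<close>.\<close>

lemma arith_prog_in_sum_diff:
  fixes A :: "int set" and N L :: nat and \<alpha> :: real
  assumes "N \<ge> 1" "0 < \<alpha>" "\<alpha> \<le> 1" "A \<subseteq> {1..int N}" "real (card A) \<ge> \<alpha> * N" "L \<ge> 1"
    and big: "10 ^ 10 * (ln (2 / \<alpha>)) ^ 3 * (ln (2 / \<alpha>) + ln L)\<^sup>2 \<le> ln N"
  shows "\<exists>y D. D > 0 \<and> (\<forall>j<L. \<exists>a\<in>A. \<exists>b\<in>A. \<exists>c\<in>A. y + int j * D = a + b - c)"
proof -
  define \<kappa> where "\<kappa> = ln (2 / \<alpha>)"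
  define \<mu> where "\<mu> = \<kappa> + ln L"
  have exp\<kappa>: "exp \<kappa> = 2 / \<alpha>" using assms(2) by (simp add: \<kappa>_def)
  have "2 \<le> 2 / \<alpha>" using assms(2,3) by (simp add: field_simps)
  then have ln2\<kappa>: "ln 2 \<le> \<kappa>" using assms(2) by (simp add: \<kappa>_def)
  have lam: "\<kappa> \<ge> 1 / 2" using ln2\<kappa> ln2_ge_two_thirds by argo
  have \<kappa>\<mu>: "\<kappa> \<le> \<mu>" using assms(6) by (simp add: \<mu>_def)
  have mu: "\<mu> \<ge> 1 / 2" using lam \<kappa>\<mu> by argo
  have ln2\<mu>: "ln 2 \<le> \<mu>" using ln2\<kappa> \<kappa>\<mu> by argo
  have \<mu>_exp: "\<mu> \<le> exp \<mu>" using exp_ge_add_one_self[of \<mu>] by argo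
  have L\<alpha>: "L / \<alpha> \<le> exp \<mu>"
    using exp\<kappa> assms(2,6) by (simp add: \<mu>_def exp_add field_simps)
  have Npos: "real N > 0" using assms(1) by simp
  have cA: "real (card A) > 0" using assms(2,5) Npos by (meson less_le_trans mult_pos_pos)
  have dens: "N / card A \<le> 1 / \<alpha>" using assms(2,5) cA by (simp add: field_simps)
  \<comment> \<open>The factor 6 comes from
    \<open>64 / \<alpha> \<le> (2 / \<alpha>) ^ 6 = exp (6 * \<kappa>)\<close>, to be bounded by
    \<open>4 ^ l\<close>.\<close>
  define l where "l = nat \<lceil>6 * \<kappa>\<rceil>"
  have l1: "6 * \<kappa> \<le> l" by (simp add: l_def real_nat_ceiling_ge)
  have "l \<le> 6 * \<kappa> + 1" using lam unfolding l_def by (intro real_nat_ceiling_le) simp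
  then have l2: "l \<le> 8 * \<kappa>" using lam by argo
  have l3: "l \<ge> 3" using l1 lam by simp
  note l = l1 l2 l3
  \<comment> \<open>As \<open>17408 = 17 * 1024\<close>, the sampling error decays like
    \<open>exp (- 17 * \<mu>)\<close>, which beats its prefactor of at most
    \<open>exp (13 * \<mu>)\<close>.\<close>
  define k where "k = nat \<lceil>17408 * (real l)\<^sup>2 * \<mu>\<rceil>"
  have lsq: "(real l)\<^sup>2 \<ge> 9" using power_mono[of 3 "real l" 2] l(3) by simp
  have l2\<mu>: "(real l)\<^sup>2 * \<mu> \<ge> 1" using mult_mono[OF lsq mu] by simp
  have k1: "17408 * ((real l)\<^sup>2 * \<mu>) \<le> k" by (simp add: k_def mult.assoc real_nat_ceiling_ge)
  have "k \<le> 17408 * ((real l)\<^sup>2 * \<mu>) + 1"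
    using l2\<mu> unfolding k_def mult.assoc by (intro real_nat_ceiling_le) simp
  also have "\<dots> \<le> 17409 * ((real l)\<^sup>2 * \<mu>)" using l2\<mu> by argo
  also have "\<dots> \<le> 17409 * ((8 * \<kappa>)\<^sup>2 * \<mu>)"
    using l(2) mu by (intro mult_left_mono mult_right_mono power_mono) auto
  finally have k2: "k \<le> 1114176 * (\<kappa>\<^sup>2 * \<mu>)" by (simp add: power_mult_distrib)
  have kge1: "real k \<ge> 1" using k1 l2\<mu> by argo
  \<comment> \<open>16 is the constant in Chang's bound, and the logarithm there is at most
    \<open>4 * (k * \<kappa>)\<close>.\<close>
  define d where "d = nat \<lceil>64 * (k * \<kappa>)\<rceil>"
  have k\<kappa>: "k * \<kappa> \<ge> 1 / 2" using mult_mono[OF kge1 lam] by simp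
  have d1: "64 * (k * \<kappa>) \<le> d" by (simp add: d_def real_nat_ceiling_ge)
  have "d \<le> 64 * (k * \<kappa>) + 1" using k\<kappa> unfolding d_def by (intro real_nat_ceiling_le) simp
  also have "\<dots> \<le> 66 * (k * \<kappa>)" using k\<kappa> by argo
  also have "\<dots> \<le> 66 * (1114176 * (\<kappa>\<^sup>2 * \<mu>) * \<kappa>)"
    using k2 lam by (intro mult_left_mono mult_right_mono) auto
  finally have d2: "d \<le> 73535616 * (\<kappa> ^ 3 * \<mu>)"
    by (simp add: power2_eq_square power3_eq_cube mult_ac)
  have dge1: "real d \<ge> 1" using d1 k\<kappa> by argo
  define Q where "Q = nat \<lceil>256 * (d * (L / \<alpha>))\<rceil>"
  have "L / \<alpha> \<ge> 1" using assms(2,3,6) by (simp add: field_simps)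
  then have dL: "d * (L / \<alpha>) \<ge> 1" using mult_mono[OF dge1, of 1 "L / \<alpha>"] by simp
  have Q1: "256 * (d * (L / \<alpha>)) \<le> Q" by (simp only: Q_def real_nat_ceiling_ge)
  have Qpos: "Q > 0" using Q1 dL by (cases Q) auto
  have "Q \<le> 256 * (d * (L / \<alpha>)) + 1" using dL unfolding Q_def by (intro real_nat_ceiling_le) simp
  also have "\<dots> \<le> 257 * (d * (L / \<alpha>))" using dL by argo
  \<comment> \<open>The exponents stem from \<open>257 \<le> 2 ^ 9\<close>, from
    \<open>73535616 \<le> 2 ^ 27\<close> together with
    \<open>\<kappa> ^ 3 * \<mu> \<le> exp (4 * \<mu>)\<close>, and from
    \<open>L / \<alpha> \<le> exp \<mu>\<close>.\<close>
  also have "\<dots> \<le> exp (9 * \<mu>) * (exp (31 * \<mu>) * exp \<mu>)"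
  proof (intro mult_mono)
    show "257 \<le> exp (9 * \<mu>)" using two_power_le_exp[OF ln2\<mu>, of 257 9] by simp
    have "\<kappa> ^ 3 * \<mu> \<le> exp \<mu> ^ 3 * exp \<mu>"
      using \<kappa>\<mu> \<mu>_exp lam mu by (intro mult_mono power_mono) auto
    also have "\<dots> = exp (4 * \<mu>)" by (simp add: exp_of_nat_mult[symmetric] exp_add[symmetric])
    finally have "73535616 * (\<kappa> ^ 3 * \<mu>) \<le> exp (27 * \<mu>) * exp (4 * \<mu>)"
      using two_power_le_exp[OF ln2\<mu>, of 73535616 27] lam mu by (intro mult_mono) auto
    then show "real d \<le> exp (31 * \<mu>)" using d2 by (simp add: exp_add[symmetric])
  qed (use L\<alpha> assms(2) in auto)
  also have "\<dots> = exp (41 * \<mu>)" by (simp add: exp_add[symmetric])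
  finally have Q2: "Q \<le> exp (41 * \<mu>)" .
  show ?thesis
  proof (rule arith_prog_in_sum_diff_parametric[of N A l k Q d L])
    show "N > 0" "A \<subseteq> {1..int N}" "A \<noteq> {}" "l > 0" "Q > 0"
      using assms l(3) cA Qpos by auto
    have "32 * real l \<le> 17408 * ((real l * real l) * \<mu>)"
    proof -
      have "real l * 1 * (1 / 2) \<le> real l * real l * \<mu>"
        using l(3) mu by (intro mult_mono) auto
      moreover have "0 \<le> real l * real l * \<mu>" using mu by simp
      ultimately show ?thesis by argo
    qed
    also have "\<dots> \<le> k" using k1 by (simp add: power2_eq_square)
    finally have "real (32 * l) \<le> real k" by simp
    then show "32 * l \<le> k" by (rule of_nat_le_iff[THEN iffD1])
    have "64 * (N / card A) \<le> 64 * (1 / \<alpha>)" using dens by (intro mult_left_mono) auto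
    also have "\<dots> = 2 ^ 5 * (2 / \<alpha>)" by simp
    also have "\<dots> \<le> (2 / \<alpha>) ^ 5 * (2 / \<alpha>)"
      using \<open>2 \<le> 2 / \<alpha>\<close> assms(2) by (intro mult_right_mono power_mono) auto
    also have "\<dots> = exp (6 * \<kappa>)"
      unfolding exp\<kappa>[symmetric] by (simp add: exp_of_nat_mult[symmetric] exp_add[symmetric])
    also have "\<dots> \<le> exp (real l)" using l(1) by simp
    also have "\<dots> = exp 1 ^ l" by (simp add: exp_of_nat_mult[symmetric])
    also have "\<dots> \<le> 4 ^ l" using exp_le by (intro power_mono) auto
    finally show "64 * real N / card A \<le> 4 ^ l" by simp
    have "8 * (2 * real N / card A) ^ k \<le> 8 * (2 / \<alpha>) ^ k"
      using dens Npos by (intro mult_left_mono power_mono) auto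
    then have "ln (8 * (2 * real N / card A) ^ k) \<le> ln (8 * (2 / \<alpha>) ^ k)"
      using Npos cA by (intro ln_mono) auto
    also have "\<dots> = ln (2 ^ 3) + k * \<kappa>"
      using assms(2) by (simp add: ln_mult ln_realpow \<kappa>_def)
    also have "\<dots> = 3 * ln 2 + k * \<kappa>" by (subst ln_realpow) auto
    also have "\<dots> \<le> 3 * (k * \<kappa>) + k * \<kappa>"
    proof -
      have "1 * \<kappa> \<le> k * \<kappa>" using kge1 lam by (intro mult_right_mono) auto
      then show ?thesis using ln2\<kappa> by argo
    qed
    finally show "16 * ln (8 * (2 * real N / card A) ^ k) \<le> d" using d1 by argo
    have "256 * real d * L * (N / card A) \<le> 256 * real d * L * (1 / \<alpha>)"
      using dens by (intro mult_left_mono) auto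
    then show "256 * real d * L * N / card A \<le> Q" using Q1 by simp
    have l\<mu>: "real l \<le> exp (3 * \<mu>) * exp \<mu>"
    proof -
      have "real l \<le> 8 * \<mu>" using l(2) \<kappa>\<mu> by argo
      also have "\<dots> \<le> exp (3 * \<mu>) * exp \<mu>"
        using two_power_le_exp[OF ln2\<mu>, of 8 3] \<mu>_exp mu by (intro mult_mono) auto
      finally show ?thesis .
    qed
    have "256 * real l * (L * (N / card A)) \<le> exp (8 * \<mu>) * (exp (3 * \<mu>) * exp \<mu>) * exp \<mu>"
    proof (intro mult_mono)
      show "256 \<le> exp (8 * \<mu>)" using two_power_le_exp[OF ln2\<mu>, of 256 8] by simp
      have "L * (N / card A) \<le> L * (1 / \<alpha>)" using dens by (intro mult_left_mono) auto
      then show "L * (N / card A) \<le> exp \<mu>" using L\<alpha> by simp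
    qed (use l\<mu> in auto)
    also have "\<dots> = exp (13 * \<mu>)" by (simp add: exp_add[symmetric])
    finally have pre: "256 * real l * L * N / card A \<le> exp (13 * \<mu>)" by simp
    have "17 * \<mu> \<le> real k / (1024 * (real l)\<^sup>2)"
      using k1 l(3) by (simp add: field_simps)
    then have "256 * real l * L * N / card A * exp (- real k / (1024 * (real l)\<^sup>2))
        \<le> exp (13 * \<mu>) * exp (- (17 * \<mu>))"
      using pre by (intro mult_mono) auto
    also have "\<dots> < 1" using mu by (simp add: exp_add[symmetric])
    finally show "256 * real l * L * N / card A * exp (- real k / (1024 * (real l)\<^sup>2)) < 1" .
    have "real L \<le> exp \<mu>" using assms(6) lam by (simp add: \<mu>_def exp_add)
    moreover have "real Q ^ d \<le> exp (41 * \<mu>) ^ d" using Q2 by (intro power_mono) auto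
    ultimately have "real L * real Q ^ d \<le> exp \<mu> * exp (41 * \<mu>) ^ d" by (intro mult_mono) auto
    also have "\<dots> = exp (\<mu> + d * (41 * \<mu>))" by (simp add: exp_add exp_of_nat_mult)
    also have "\<dots> \<le> exp (ln N)"
    proof -
      \<comment> \<open>Absorbs the lone \<open>\<mu>\<close>; the total constant
        \<open>16 + 41 * 73535616\<close> is below \<open>10 ^ 10\<close>.\<close>
      have "1 / 16 \<le> \<kappa> ^ 3 * \<mu>"
        using mult_mono[of "(1/2)^3" "\<kappa>^3" "1/2" \<mu>] power_mono[OF lam, of 3] mu lam
        by (simp add: power_divide)
      then have "\<mu> * (1 / 16) \<le> \<mu> * (\<kappa> ^ 3 * \<mu>)" using mu by (intro mult_left_mono) auto
      moreover have "d * (41 * \<mu>) \<le> 73535616 * (\<kappa> ^ 3 * \<mu>) * (41 * \<mu>)"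
        using d2 mu by (intro mult_right_mono) auto
      moreover have "10 ^ 10 * (\<mu> * (\<kappa> ^ 3 * \<mu>)) \<le> ln N"
        using big by (simp add: \<kappa>_def[symmetric] \<mu>_def[symmetric] power2_eq_square mult_ac)
      moreover have "0 \<le> \<mu> * (\<kappa> ^ 3 * \<mu>)" using lam mu by simp
      ultimately have "\<mu> + d * (41 * \<mu>) \<le> ln N" by (simp add: mult_ac)
      then show ?thesis by simp
    qed
    also have "\<dots> = N" using Npos by simp
    finally have "real (L * Q ^ d) \<le> real N" by simp
    then show "L * Q ^ d \<le> N" by (rule of_nat_le_iff[THEN iffD1])
  qed
qed

section \<open>From \<open>B + B - B\<close> back to \<open>A + A + A\<close>\<close>

text \<open>Pigeonhole over the \<open>2 * N\<close> possible values of a sum; a pair with given sum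
  is determined by its first entry.\<close>

lemma popular_sum_exists:
  fixes A :: "nat set"
  assumes "N \<ge> 1" "A \<subseteq> {1..N}"
  obtains x B where "B \<subseteq> A" "\<And>b. b \<in> B \<Longrightarrow> b \<le> x \<and> x - b \<in> A" "(card A)\<^sup>2 \<le> card B * (2 * N)"
proof -
  have fin: "finite A" using assms(2) finite_subset by blast
  define h where "h = (\<lambda>p::nat \<times> nat. fst p + snd p)"
  have "\<exists>x\<in>{1..2 * N}. card (A \<times> A) \<le> card (h -` {x} \<inter> (A \<times> A)) * card {1..2 * N}"
  proof (rule pigeonhole_card)
    show "h \<in> A \<times> A \<rightarrow> {1..2 * N}"
    proof (rule Pi_I)
      fix p assume "p \<in> A \<times> A"
      then have "fst p \<in> {1..N}" "snd p \<in> {1..N}" using assms(2) by auto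
      then show "h p \<in> {1..2 * N}" by (auto simp: h_def)
    qed
  qed (use assms(1) fin in auto)
  then obtain x where x: "card (A \<times> A) \<le> card (h -` {x} \<inter> (A \<times> A)) * card {1..2 * N}" by blast
  define B where "B = fst ` (h -` {x} \<inter> (A \<times> A))"
  have "inj_on fst (h -` {x} \<inter> (A \<times> A))" by (auto simp: inj_on_def h_def)
  then have "card B = card (h -` {x} \<inter> (A \<times> A))" unfolding B_def by (rule card_image)
  then have "(card A)\<^sup>2 \<le> card B * (2 * N)" using x by (simp add: card_cartesian_product power2_eq_square)
  moreover have "B \<subseteq> A" by (auto simp: B_def)
  moreover have "b \<le> x \<and> x - b \<in> A" if "b \<in> B" for b using that by (auto simp: B_def h_def)
  ultimately show thesis using that by metis
qed

text \<open>For the density \<open>\<beta> = \<alpha>\<^sup>2 / 2\<close> of \<open>B\<close>,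
  \<open>2 / \<beta> = (2 / \<alpha>)\<^sup>2\<close> doubles the logarithm, hence the factors 2 in
  \<open>big\<close>. Adding \<open>x\<close> turns \<open>a + b - c\<close> into
  \<open>a + b + (x - c)\<close> with \<open>x - c \<in> A\<close>.\<close>

lemma arith_prog_in_sum_sum:
  fixes A :: "nat set" and N L :: nat and \<alpha> :: real
  assumes "N \<ge> 1" "0 < \<alpha>" "\<alpha> \<le> 1" "A \<subseteq> {1..N}" "real (card A) \<ge> \<alpha> * N" "L \<ge> 1"
    and big: "10 ^ 10 * (2 * ln (2 / \<alpha>)) ^ 3 * (2 * ln (2 / \<alpha>) + ln L)\<^sup>2 \<le> ln N"
  shows "\<exists>P. is_arith_prog L P \<and> P \<subseteq> A + A + A"
proof -
  obtain x B where B: "B \<subseteq> A" "\<And>b. b \<in> B \<Longrightarrow> b \<le> x \<and> x - b \<in> A" "(card A)\<^sup>2 \<le> card B * (2 * N)"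
    using popular_sum_exists[OF assms(1,4)] by metis
  define \<beta> where "\<beta> = \<alpha>\<^sup>2 / 2"
  have \<beta>: "0 < \<beta>" "\<beta> \<le> 1" using assms(2,3) power_le_one[of \<alpha> 2] by (auto simp: \<beta>_def)
  have "2 / \<beta> = (2 / \<alpha>)\<^sup>2" by (simp add: \<beta>_def power_divide)
  then have ln\<beta>: "ln (2 / \<beta>) = 2 * ln (2 / \<alpha>)" using assms(2) by (simp add: ln_realpow)
  have "(\<alpha> * N)\<^sup>2 \<le> (real (card A))\<^sup>2" using assms(2,5) by (intro power_mono) auto
  also have "\<dots> \<le> real (card B * (2 * N))" using B(3) by (simp flip: of_nat_power of_nat_mult)
  finally have "\<beta> * N * (2 * N) \<le> card B * (2 * real N)" by (simp add: \<beta>_def power2_eq_square field_simps)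
  then have cB: "\<beta> * N \<le> card (int ` B)" using assms(1) by (simp add: card_image)
  have BN: "int ` B \<subseteq> {1..int N}" using B(1) assms(4) by fastforce
  obtain y D where D: "D > 0"
    "\<And>j. j < L \<Longrightarrow> \<exists>a\<in>int ` B. \<exists>b\<in>int ` B. \<exists>c\<in>int ` B. y + int j * D = a + b - c"
    using arith_prog_in_sum_diff[OF assms(1) \<beta> BN cB assms(6)] big unfolding ln\<beta> by blast
  have mem: "y + int x + int j * D \<in> int ` (A + A + A)" if "j < L" for j
  proof -
    obtain a b c where abc: "a \<in> B" "b \<in> B" "c \<in> B" "y + int j * D = int a + int b - int c"
      using D(2)[OF \<open>j < L\<close>] by blast
    have "y + int x + int j * D = int (a + b + (x - c))" using abc(4) B(2)[OF abc(3)] by simp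
    moreover have "a + b + (x - c) \<in> A + A + A"
      using abc B by (intro set_plus_intro) auto
    ultimately show ?thesis by blast
  qed
  define z where "z = nat (y + int x)"
  \<comment> \<open>The term for \<open>j = 0\<close> is itself a sum of elements of
    \<open>A\<close>, so the starting point is a natural number.\<close>
  have "0 \<le> y + int x" using mem[of 0] assms(6) by auto
  then have z: "int z = y + int x" by (simp add: z_def)
  have "z + j * nat D \<in> A + A + A" if "j < L" for j
  proof -
    have "int (z + j * nat D) = y + int x + int j * D" using z D(1) by simp
    then have "int (z + j * nat D) \<in> int ` (A + A + A)" using mem[OF that] by (simp only:)
    then show ?thesis by (simp only: inj_image_mem_iff[OF inj_of_nat])
  qed
  then have "(\<lambda>j. z + j * nat D) ` {..<L} \<subseteq> A + A + A" by blast
  moreover have "is_arith_prog L ((\<lambda>j. z + j * nat D) ` {..<L})"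
    using D(1) unfolding is_arith_prog_def by (intro exI[of _ z] exI[of _ "nat D"]) auto
  ultimately show ?thesis by blast
qed

section \<open>Short progressions and the final bound\<close>

lemma arith_prog_length_1:
  assumes "a \<in> (S::nat set)"
  shows "\<exists>P. is_arith_prog 1 P \<and> P \<subseteq> S"
proof -
  have "{a} = (\<lambda>i. a + i * 1) ` {..<1}" by auto
  then have "is_arith_prog 1 {a}" unfolding is_arith_prog_def using zero_less_one by blast
  then show ?thesis using assms by blast
qed

lemma arith_prog_length_2:
  assumes "a \<in> (S::nat set)" "b \<in> S" "a < b"
  shows "\<exists>P. is_arith_prog 2 P \<and> P \<subseteq> S"
proof -
  have "{..<2} = {0, 1::nat}" by auto
  then have "{a, b} = (\<lambda>i. a + i * (b - a)) ` {..<2}" using assms(3) by simp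
  moreover have "0 < b - a" using assms(3) by simp
  ultimately have "is_arith_prog 2 {a, b}" unfolding is_arith_prog_def by blast
  then show ?thesis using assms(1,2) by blast
qed

theorem theorem1p6:
  shows "\<exists>c::real. c > 0 \<and>
    (\<forall>(N::nat) (\<alpha>::real) (A::nat set).
       N \<ge> 1 \<longrightarrow> 0 < \<alpha> \<longrightarrow> \<alpha> \<le> 1 \<longrightarrow> A \<subseteq> {1..N} \<longrightarrow> real (card A) \<ge> \<alpha> * real N \<longrightarrow>
       (\<exists>k P. is_arith_prog k P \<and> P \<subseteq> A + A + A \<and>
          real k \<ge> \<alpha> * exp (sqrt (c * ln (real N) / (ln (2 / \<alpha>)) ^ 3))))"
proof (intro exI[of _ "1 / 10 ^ 13 :: real"] conjI allI impI)
  fix N :: nat and \<alpha> :: real and A :: "nat set"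
  assume N: "N \<ge> 1" and \<alpha>: "0 < \<alpha>" "\<alpha> \<le> 1" and A: "A \<subseteq> {1..N}" "real (card A) \<ge> \<alpha> * real N"
  define \<Lambda> where "\<Lambda> = sqrt (1 / 10 ^ 13 * ln (real N) / (ln (2 / \<alpha>)) ^ 3)"
  have fin: "finite A" using A(1) finite_subset by blast
  have lam: "ln (2 / \<alpha>) = ln 2 - ln \<alpha>" using \<alpha> by (simp add: ln_div)
  have ln\<alpha>: "ln \<alpha> \<le> 0" using \<alpha> by simp
  have ln2: "(ln 2 :: real) > 0" by simp
  have lam_pos: "ln (2 / \<alpha>) > 0" unfolding lam using ln\<alpha> ln2 by linarith
  have lnN: "ln (real N) \<ge> 0" using N by simp
  have \<Lambda>0: "\<Lambda> \<ge> 0" using lnN lam_pos by (simp add: \<Lambda>_def)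
  have "\<Lambda>\<^sup>2 = 1 / 10 ^ 13 * ln (real N) / (ln (2 / \<alpha>)) ^ 3"
    using lnN lam_pos by (simp add: \<Lambda>_def)
  then have lnN_eq: "ln (real N) = 10 ^ 13 * (ln (2 / \<alpha>) ^ 3 * \<Lambda>\<^sup>2)"
    using lam_pos by (simp add: field_simps)
  have "0 < \<alpha> * real N" using N \<alpha> by simp
  then have "card A > 0" using A(2) by linarith
  then obtain a where a: "a \<in> A" by fastforce
  have a3: "a + a + a \<in> A + A + A" using a by (intro set_plus_intro)
  have "\<exists>k P. is_arith_prog k P \<and> P \<subseteq> A + A + A \<and> real k \<ge> \<alpha> * exp \<Lambda>"
  \<comment> \<open>Three ranges: a single point serves a target of at most 1, two points serve when
    \<open>\<Lambda> < ln 2\<close>, and the parameter choice covers the rest.\<close>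
  proof (cases "\<alpha> * exp \<Lambda> \<le> 1")
    case True
    then show ?thesis using arith_prog_length_1[OF a3] by fastforce
  next
    case False
    then have "ln 1 < ln (\<alpha> * exp \<Lambda>)" using \<alpha> by (subst ln_less_cancel_iff) auto
    then have \<Lambda>\<alpha>: "- ln \<alpha> < \<Lambda>" using \<alpha> by (simp add: ln_mult)
    show ?thesis
    proof (cases "\<Lambda> \<ge> ln 2")
      case True
      define L where "L = nat \<lceil>\<alpha> * exp \<Lambda>\<rceil>"
      have L1: "\<alpha> * exp \<Lambda> \<le> L" by (simp add: L_def real_nat_ceiling_ge)
      have "L \<ge> 1" using L1 False by (cases L) auto
      have "L \<le> \<alpha> * exp \<Lambda> + 1" using False unfolding L_def by linarith
      also have "\<dots> \<le> 2 * (\<alpha> * exp \<Lambda>)" using False by linarith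
      also have "\<dots> \<le> 2 * (1 * exp \<Lambda>)" using \<alpha> by (intro mult_left_mono mult_right_mono) auto
      finally have "ln L \<le> ln (2 * exp \<Lambda>)" using \<open>L \<ge> 1\<close> by (intro ln_mono) auto
      then have lnL: "ln L \<le> ln 2 + \<Lambda>" by (simp add: ln_mult)
      \<comment> \<open>The left side is at most
        \<open>3 * ln 2 - 2 * ln \<alpha> + \<Lambda>\<close>, and both \<open>ln 2\<close> and
        \<open>- ln \<alpha>\<close> are at most \<open>\<Lambda>\<close>.\<close>
      have "2 * ln (2 / \<alpha>) + ln L \<le> 6 * \<Lambda>"
        unfolding lam using lnL \<Lambda>\<alpha> True by argo
      moreover have "0 \<le> 2 * ln (2 / \<alpha>) + ln L" using lam_pos \<open>L \<ge> 1\<close> by simp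
      ultimately have "(2 * ln (2 / \<alpha>) + ln L)\<^sup>2 \<le> (6 * \<Lambda>)\<^sup>2" by (intro power_mono)
      then have "10 ^ 10 * (2 * ln (2 / \<alpha>)) ^ 3 * (2 * ln (2 / \<alpha>) + ln L)\<^sup>2
          \<le> 10 ^ 10 * (2 * ln (2 / \<alpha>)) ^ 3 * (6 * \<Lambda>)\<^sup>2"
        using lam_pos by (intro mult_left_mono) auto
      \<comment> \<open>\<open>288 = 2 ^ 3 * 6\<^sup>2\<close>; the constant
        \<open>1 / 10 ^ 13\<close> is chosen so that \<open>288 * 10 ^ 10 \<le> 10 ^ 13\<close>
        suffices.\<close>
      also have "\<dots> = 288 * 10 ^ 10 * (ln (2 / \<alpha>) ^ 3 * \<Lambda>\<^sup>2)"
        by (simp add: power_mult_distrib)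
      also have "\<dots> \<le> ln (real N)"
        unfolding lnN_eq using lam_pos by (intro mult_right_mono) auto
      finally have "10 ^ 10 * (2 * ln (2 / \<alpha>)) ^ 3 * (2 * ln (2 / \<alpha>) + ln L)\<^sup>2 \<le> ln (real N)" .
      from arith_prog_in_sum_sum[OF N \<alpha> A \<open>L \<ge> 1\<close> this] L1 show ?thesis by blast
    next
      case small: False
      have "exp \<Lambda> < 2" using small by (metis exp_less_cancel_iff exp_ln not_le zero_less_numeral)
      then have "\<alpha> * exp \<Lambda> \<le> 1 * 2" using \<alpha> by (intro mult_mono) auto
      have "\<alpha> > 1 / 2"
      proof (rule ccontr)
        assume "\<not> \<alpha> > 1 / 2"
        then have "\<alpha> * exp \<Lambda> \<le> 1 / 2 * 2" using \<open>exp \<Lambda> < 2\<close> \<alpha> by (intro mult_mono) auto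
        then show False using False by simp
      qed
      \<comment> \<open>For \<open>N = 1\<close> the target would be
        \<open>\<alpha> \<le> 1\<close>. With \<open>N \<ge> 2\<close> and
        \<open>\<alpha> > 1 / 2\<close> the set \<open>A\<close> has two elements.\<close>
      have "N \<noteq> 1"
      proof
        assume "N = 1"
        then have "\<Lambda> = 0" by (simp add: \<Lambda>_def)
        then show False using False \<alpha> by simp
      qed
      then have "real N \<ge> 2" using N by simp
      then have "1 / 2 * 2 < \<alpha> * real N"
        using \<open>\<alpha> > 1 / 2\<close> by (intro mult_less_le_imp_less) auto
      then have "card A > 1" using A(2) by linarith
      then obtain a b where ab: "a \<in> A" "b \<in> A" "a \<noteq> b"
        by (metis card_le_Suc0_iff_eq fin not_less One_nat_def)
      then obtain a b where "a \<in> A" "b \<in> A" "a < b" by (meson linorder_neqE_nat)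
      then have "a + a + a \<in> A + A + A" "a + a + b \<in> A + A + A" "a + a + a < a + a + b"
        by (auto intro!: set_plus_intro)
      from arith_prog_length_2[OF this] show ?thesis
        using \<open>\<alpha> * exp \<Lambda> \<le> 1 * 2\<close> by fastforce
    qed
  qed
  then show "\<exists>k P. is_arith_prog k P \<and> P \<subseteq> A + A + A \<and>
      real k \<ge> \<alpha> * exp (sqrt (1 / 10 ^ 13 * ln (real N) / (ln (2 / \<alpha>)) ^ 3))"
    by (simp add: \<Lambda>_def)
qed simp

end
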